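(* Let $T_1, T_2$ be locally finite trees and, for $i=1,2$, let $G_i<\mathrm{Aut}(T_i)$ be a closed, non-discrete, locally quasi-primitive subgroup of constant type. Let $M_i$ denote a simple factor of a minimal normal subgroup of the local permutation group $\underline{G}_i(x)$, and let $S_i$ denote the stabilizer in $\underline{G}_i(x)$ of an element of $E(x)$, where $x$ is a vertex of $T_i$. Let $\Gamma< G_1 \times G_2$ be a cocompact lattice with dense projections on $G_1$ and $G_2$. Then there is a neighborhood $W$ of $(e,e)$ in $G_1\times G_2$ with the following property: if there is a discrete subgroup $\Lambda < G_1 \times G_2$ containing $\Gamma$ with $\Lambda \cap W \neq \{ (e,e)\}$, then $M_1$ is a section of $S_2$ and $M_2$ is a section of $S_1$.
   Context: For a locally finite tree $T$, $\mathrm{Aut}(T)$ carries its usual locally compact topology (pointwise convergence on vertices). For a subgroup $H < \mathrm{Aut}(T)$ and a vertex $x$ of $T$, let $E(x)$ be the (finite) set of edges issued from $x$, $H(x)$ the stabilizer of $x$ in $H$, and $\underline{H}(x) < \mathrm{Sym}\,E(x)$ the finite permutation group induced by the action of $H(x)$ on $E(x)$ (the local permutation group at $x$). A finite permutation group $F < \mathrm{Sym}\,\Omega$ is quasi-primitive if every non-trivial normal subgroup of $F$ acts transitively on $\Omega$. $H$ is locally quasi-primitive if $\underline{H}(x)$ is quasi-primitive for every vertex $x$. $H$ is of constant type if for every vertex $x$ the permutation group $\underline{H}(x)$ is isomorphic, as a permutation group, to one fixed permutation group. A minimal normal subgroup of a finite group is a direct product of isomorphic simple groups. A quasi-primitive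 permutation group has either one or two minimal normal subgroups, and in the latter case the two are isomorphic; hence the isomorphism class of a simple factor of a minimal normal subgroup is well defined. Because $G_i$ is of constant type and locally quasi-primitive, the isomorphism classes of $M_i$ and $S_i$ do not depend on the choices of vertex, minimal normal subgroup, or edge. A section of a group $S$ is a quotient $A/B$ of a subgroup $A < S$ by a normal subgroup $B$ of $A$; "$M$ is a section of $S$" means $M$ is isomorphic to a section of $S$. *)

theory Defs
  imports
    "HOL-Analysis.Analysis"
    "HOL-Algebra.Group_Action"
    "HOL-Algebra.SimpleGroups"
    "HOL-Algebra.Product_Groups"
    "Graph_Theory.Graph_Theory"
begin

section \<open>Locally finite trees\<close>

text \<open>
  An undirected simple graph is a (possibly infinite) bidirected loop-free digraph: an edge between
  \<open>u\<close> and \<open>v\<close> is the pair of arcs \<open>(u, v)\<close>, \<open>(v, u)\<close>. In such a digraph the walk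
  \<open>u, v, u\<close> counts as a cycle for the library, so the library predicate for trees cannot be used;
  the cycles of the undirected graph are the digraph cycles of length at least 3.
\<close>

definition undirected_tree :: "'a pair_pre_digraph \<Rightarrow> bool" where
  "undirected_tree T \<longleftrightarrow>
     pair_bidirected_digraph T \<and>
     Digraph_Component.connected (with_proj T) \<and>
     \<not> (\<exists>p. pre_digraph.cycle (with_proj T) p \<and> 3 \<le> length p)"

text \<open>The set of edges issued from a vertex consists of the arcs with that tail.\<close>

abbreviation edges_from :: "'a pair_pre_digraph \<Rightarrow> 'a \<Rightarrow> ('a \<times> 'a) set" where
  "edges_from T x \<equiv> out_arcs (with_proj T) x"

definition locally_finite_tree :: "'a pair_pre_digraph \<Rightarrow> bool" where
  "locally_finite_tree T \<longleftrightarrow>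
     undirected_tree T \<and> (\<forall>x \<in> pverts T. finite (edges_from T x))"


section \<open>The automorphism group and its topology\<close>

text \<open>Automorphisms are extended by \<^const>\<open>undefined\<close> outside the vertex set, as in \<^const>\<open>Bij\<close>.\<close>

definition automorphisms :: "'a pair_pre_digraph \<Rightarrow> ('a \<Rightarrow> 'a) set" where
  "automorphisms T =
     {g \<in> Bij (pverts T).
        \<forall>u \<in> pverts T. \<forall>v \<in> pverts T. (g u, g v) \<in> parcs T \<longleftrightarrow> (u, v) \<in> parcs T}"

text \<open>For a set \<open>F\<close> of permutations of \<open>X\<close>, the set \<open>F\<close> with composition as multiplication.\<close>

abbreviation perm_group :: "'a set \<Rightarrow> ('a \<Rightarrow> 'a) set \<Rightarrow> ('a \<Rightarrow> 'a) monoid" where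
  "perm_group X F \<equiv> (BijGroup X)\<lparr>carrier := F\<rparr>"

abbreviation aut_group :: "'a pair_pre_digraph \<Rightarrow> ('a \<Rightarrow> 'a) monoid" where
  "aut_group T \<equiv> perm_group (pverts T) (automorphisms T)"

definition aut_topology :: "'a pair_pre_digraph \<Rightarrow> ('a \<Rightarrow> 'a) topology" where
  "aut_topology T =
     subtopology (product_topology (\<lambda>_. discrete_topology (pverts T)) (pverts T)) (automorphisms T)"


section \<open>Local permutation groups\<close>

definition local_perms :: "'a pair_pre_digraph \<Rightarrow> ('a \<Rightarrow> 'a) set \<Rightarrow> 'a \<Rightarrow> ('a \<times> 'a \<Rightarrow> 'a \<times> 'a) set" where
  "local_perms T H x = (\<lambda>h. restrict (map_prod h h) (edges_from T x)) ` {h \<in> H. h x = x}"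

abbreviation local_group ::
    "'a pair_pre_digraph \<Rightarrow> ('a \<Rightarrow> 'a) set \<Rightarrow> 'a \<Rightarrow> ('a \<times> 'a \<Rightarrow> 'a \<times> 'a) monoid" where
  "local_group T H x \<equiv> perm_group (edges_from T x) (local_perms T H x)"

definition quasi_primitive :: "'a set \<Rightarrow> ('a \<Rightarrow> 'a) set \<Rightarrow> bool" where
  "quasi_primitive X F \<longleftrightarrow>
     (\<forall>N. N \<lhd> perm_group X F \<and> N \<noteq> {\<one>\<^bsub>perm_group X F\<^esub>} \<longrightarrow>
          transitive_action (perm_group X N) X (\<lambda>f. f))"

definition locally_quasi_primitive :: "'a pair_pre_digraph \<Rightarrow> ('a \<Rightarrow> 'a) set \<Rightarrow> bool" where
  "locally_quasi_primitive T H \<longleftrightarrow>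
     (\<forall>x \<in> pverts T. quasi_primitive (edges_from T x) (local_perms T H x))"

definition perm_isomorphic ::
    "'a set \<Rightarrow> ('a \<Rightarrow> 'a) set \<Rightarrow> 'b set \<Rightarrow> ('b \<Rightarrow> 'b) set \<Rightarrow> bool" where
  "perm_isomorphic X F Y F' \<longleftrightarrow>
     (\<exists>\<beta> \<phi>. bij_betw \<beta> X Y \<and> \<phi> \<in> iso (perm_group X F) (perm_group Y F') \<and>
            (\<forall>f \<in> F. \<forall>a \<in> X. \<beta> (f a) = \<phi> f (\<beta> a)))"

text \<open>
  The fixed permutation group may be taken on a set of pairs of vertices, since it is isomorphic to
  the local permutation group at some vertex.
\<close>

definition constant_type :: "'a pair_pre_digraph \<Rightarrow> ('a \<Rightarrow> 'a) set \<Rightarrow> bool" where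
  "constant_type T H \<longleftrightarrow>
     (\<exists>(Y :: ('a \<times> 'a) set) F. subgroup F (BijGroup Y) \<and>
        (\<forall>x \<in> pverts T. perm_isomorphic (edges_from T x) (local_perms T H x) Y F))"


section \<open>Minimal normal subgroups, simple factors, sections\<close>

definition minimal_normal :: "'a set \<Rightarrow> ('a, 'b) monoid_scheme \<Rightarrow> bool" where
  "minimal_normal N F \<longleftrightarrow>
     N \<lhd> F \<and> N \<noteq> {\<one>\<^bsub>F\<^esub>} \<and>
     (\<forall>K. K \<lhd> F \<and> K \<subseteq> N \<and> K \<noteq> {\<one>\<^bsub>F\<^esub>} \<longrightarrow> K = N)"

text \<open>
  A minimal normal subgroup of a finite group is a direct product of isomorphic simple groups;
  a simple factor is any group in the isomorphism class of these.
\<close>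

definition simple_factor :: "'m monoid \<Rightarrow> ('a, 'b) monoid_scheme \<Rightarrow> bool" where
  "simple_factor M N \<longleftrightarrow>
     simple_group M \<and> (\<exists>n::nat. N \<cong> product_group {..<n} (\<lambda>_. M))"

definition is_section_of :: "('a, 'b) monoid_scheme \<Rightarrow> ('c, 'd) monoid_scheme \<Rightarrow> bool" where
  "is_section_of M S \<longleftrightarrow>
     (\<exists>A B. subgroup A S \<and> B \<lhd> S\<lparr>carrier := A\<rparr> \<and> M \<cong> S\<lparr>carrier := A\<rparr> Mod B)"


section \<open>Discrete subgroups and lattices\<close>

definition discrete_in :: "'g topology \<Rightarrow> 'g set \<Rightarrow> bool" where
  "discrete_in X D \<longleftrightarrow> subtopology X D = discrete_topology D"

definition discrete_subgroup :: "('g, 'r) monoid_scheme \<Rightarrow> 'g topology \<Rightarrow> 'g set \<Rightarrow> bool" where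
  "discrete_subgroup G X D \<longleftrightarrow> subgroup D G \<and> discrete_in X D"

text \<open>
  The topology \<open>Y\<close> is determined by \<open>quotient_map X Y (\<lambda>g. g <#\<^bsub>G\<^esub> D)\<close>: it is the
  quotient topology on the set \<open>G/D\<close> of left cosets.
\<close>

definition cocompact :: "('g, 'r) monoid_scheme \<Rightarrow> 'g topology \<Rightarrow> 'g set \<Rightarrow> bool" where
  "cocompact G X D \<longleftrightarrow> (\<exists>Y. quotient_map X Y (\<lambda>g. g <#\<^bsub>G\<^esub> D) \<and> compact_space Y)"

text \<open>
  A lattice is a discrete subgroup such that the Borel \<open>\<sigma>\<close>-algebra of \<open>G/D\<close> carries a nonzero
  finite measure invariant under left translations.
\<close>

definition lattice_subgroup :: "('g, 'r) monoid_scheme \<Rightarrow> 'g topology \<Rightarrow> 'g set \<Rightarrow> bool" where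
  "lattice_subgroup G X D \<longleftrightarrow>
     discrete_subgroup G X D \<and>
     (\<exists>Y \<mu>. quotient_map X Y (\<lambda>g. g <#\<^bsub>G\<^esub> D) \<and>
            space \<mu> = topspace Y \<and>
            sets \<mu> = sigma_sets (topspace Y) {U. openin Y U} \<and>
            emeasure \<mu> (space \<mu>) \<noteq> 0 \<and> emeasure \<mu> (space \<mu>) \<noteq> \<infinity> \<and>
            (\<forall>g \<in> carrier G. \<forall>A \<in> sets \<mu>. emeasure \<mu> ((\<lambda>C. g <#\<^bsub>G\<^esub> C) ` A) = emeasure \<mu> A))"


section \<open>Products of two groups of tree automorphisms\<close>

abbreviation tree_prod_group ::
    "'a pair_pre_digraph \<Rightarrow> ('a \<Rightarrow> 'a) set \<Rightarrow> 'b pair_pre_digraph \<Rightarrow> ('b \<Rightarrow> 'b) set \<Rightarrow>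
       (('a \<Rightarrow> 'a) \<times> ('b \<Rightarrow> 'b)) monoid" where
  "tree_prod_group T1 G1 T2 G2 \<equiv> perm_group (pverts T1) G1 \<times>\<times> perm_group (pverts T2) G2"

abbreviation tree_prod_topology ::
    "'a pair_pre_digraph \<Rightarrow> ('a \<Rightarrow> 'a) set \<Rightarrow> 'b pair_pre_digraph \<Rightarrow> ('b \<Rightarrow> 'b) set \<Rightarrow>
       (('a \<Rightarrow> 'a) \<times> ('b \<Rightarrow> 'b)) topology" where
  "tree_prod_topology T1 G1 T2 G2 \<equiv>
     prod_topology (subtopology (aut_topology T1) G1) (subtopology (aut_topology T2) G2)"

end

theory Submission
  imports Defs
begin

text \<open>
  Let \<open>\<Lambda>\<close> be a discrete group between \<open>\<Gamma>\<close> and \<open>G1 \<times> G2\<close>. Its projections are dense, so at every vertex it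
  induces the full local permutation group, and by discreteness the stabilizer in \<open>\<Lambda>\<close> of a pair of vertices is
  finite (\<open>finite_stabilizers\<close>). Three facts combine.

  First, an element of \<open>\<Lambda>\<close> that is trivial on one tree and fixes a vertex of the other is trivial
  (\<open>trivial_on_other_tree_imp_free\<close>). Otherwise quasi-primitivity would make finitely many finite
  subgroups of the kernel act transitively on stars around some vertex, and an element of \<open>\<Lambda>\<close> fixing a large
  finite set would centralize them and hence be trivial on the tree, contradicting that the closure of
  the projection is not discrete.

  Second, cocompactness gives a radius \<open>R\<close>, depending only on \<open>\<Gamma>\<close>, such that for every vertex \<open>x\<close> of the first
  tree each local permutation at \<open>x\<close> is induced by an element of \<open>\<Gamma>\<close> which moves the base point \<open>x2\<close> of the
  second tree by at most \<open>R\<close> (\<open>bounded_lifts\<close>). Let \<open>W\<close> consist of the elements that fix the balls of radius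
  one more around both base points. A nontrivial element of \<open>\<Lambda> \<inter> W\<close> is nontrivial on the first tree by the first
  fact, so it fixes a vertex \<open>x\<close> of it and moves a neighbour of \<open>x\<close>. Its conjugates by the elements of \<open>\<Gamma>\<close> just
  described generate a normal subgroup of the local permutation group at \<open>x\<close>, and they still fix the star of
  \<open>x2\<close>. Thus the finite group of elements of \<open>\<Lambda>\<close> that fix \<open>x\<close> and the star of \<open>x2\<close> has an image at \<open>x\<close> that contains
  a nontrivial normal subgroup (\<open>normal_subgroup_from_short_element\<close>). Such a subgroup contains a
  minimal normal one, which maps onto \<open>M1\<close>, since any two minimal normal subgroups of a quasi-primitive
  group are isomorphic.

  Third, that finite group acts faithfully on the second tree by the first fact and fixes a star there.
  A simple quotient of a subgroup of it survives in the local action, at some vertex, of a group which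
  fixes an edge (\<open>simple_quotient_seen_at_edge\<close>), and is therefore a section of \<open>S2\<close>. Exchanging the trees gives the
  other half.
\<close>

section \<open>Sections and simple factors\<close>

text \<open>
  Sections are produced from two homomorphisms out of one group \<open>A\<close>: the one onto \<open>M\<close> factors through the
  image of the other one as soon as the kernels are nested, so \<open>M\<close> is a quotient of a subgroup of \<open>S\<close>.
\<close>

lemma quotient_section:
  assumes A: "group A" and S: "group S" and M: "group M"
    and \<phi>: "\<phi> \<in> epi A M" and \<psi>: "\<psi> \<in> hom A S"
    and ker: "\<And>a. a \<in> carrier A \<Longrightarrow> \<psi> a = \<one>\<^bsub>S\<^esub> \<Longrightarrow> \<phi> a = \<one>\<^bsub>M\<^esub>"
  shows "is_section_of M S"
proof -
  interpret P: group_hom A S \<psi> using A S \<psi> by (simp add: group_hom_def group_hom_axioms_def)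
  interpret F: group_hom A M \<phi> using A M \<phi> by (simp add: group_hom_def group_hom_axioms_def epi_def)
  have surj: "\<phi> ` carrier A = carrier M" using \<phi> by (simp add: epi_def)
  let ?B = "\<psi> ` carrier A"
  let ?SB = "S\<lparr>carrier := ?B\<rparr>"
  have sub: "subgroup ?B S" by (rule P.img_is_subgroup)
  then have grp: "group ?SB" by (rule P.H.subgroup_imp_group)
  have well: "\<phi> a = \<phi> b" if "a \<in> carrier A" "b \<in> carrier A" "\<psi> a = \<psi> b" for a b
  proof -
    have "\<psi> (a \<otimes>\<^bsub>A\<^esub> inv\<^bsub>A\<^esub> b) = \<one>\<^bsub>S\<^esub>" using that by simp
    then have "\<phi> (a \<otimes>\<^bsub>A\<^esub> inv\<^bsub>A\<^esub> b) = \<one>\<^bsub>M\<^esub>" using that ker by simp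
    then show ?thesis using that by (simp add: F.H.inv_solve_right')
  qed
  define \<theta> where "\<theta> s = \<phi> (SOME a. a \<in> carrier A \<and> \<psi> a = s)" for s
  have \<theta>: "\<theta> (\<psi> a) = \<phi> a" if "a \<in> carrier A" for a
  proof -
    let ?b = "SOME b. b \<in> carrier A \<and> \<psi> b = \<psi> a"
    have "?b \<in> carrier A \<and> \<psi> ?b = \<psi> a" by (rule someI[where x = a]) (use that in auto)
    then show ?thesis unfolding \<theta>_def using that well by blast
  qed
  have "\<theta> \<in> hom ?SB M"
  proof (rule homI)
    show "\<theta> x \<in> carrier M" if "x \<in> carrier ?SB" for x using that \<theta> by auto
    show "\<theta> (x \<otimes>\<^bsub>?SB\<^esub> y) = \<theta> x \<otimes>\<^bsub>M\<^esub> \<theta> y" if xy: "x \<in> carrier ?SB" "y \<in> carrier ?SB" for x y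
    proof -
      obtain a b where ab: "a \<in> carrier A" "b \<in> carrier A" "x = \<psi> a" "y = \<psi> b" using xy by auto
      then have "x \<otimes>\<^bsub>?SB\<^esub> y = \<psi> (a \<otimes>\<^bsub>A\<^esub> b)" by simp
      then have "\<theta> (x \<otimes>\<^bsub>?SB\<^esub> y) = \<phi> (a \<otimes>\<^bsub>A\<^esub> b)" using ab \<theta> by (metis P.G.m_closed)
      then show ?thesis using ab \<theta> by simp
    qed
  qed
  then interpret T: group_hom ?SB M \<theta>
    using grp M by (simp add: group_hom_def group_hom_axioms_def)
  have "\<theta> ` carrier ?SB = carrier M"
  proof -
    have "\<theta> ` \<psi> ` carrier A = \<phi> ` carrier A" unfolding image_image using \<theta> by (rule image_cong[OF refl])
    then show ?thesis using surj by simp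
  qed
  then have "?SB Mod kernel ?SB M \<theta> \<cong> M" by (rule T.FactGroup_iso)
  moreover have "group (?SB Mod kernel ?SB M \<theta>)"
    by (rule normal.factorgroup_is_group[OF T.normal_kernel])
  ultimately have "M \<cong> ?SB Mod kernel ?SB M \<theta>"
    by (meson group.iso_sym)
  then show ?thesis unfolding is_section_of_def using sub T.normal_kernel by blast
qed

lemma epi_onto_simple_factor:
  assumes N: "group N" and f: "simple_factor M N" and nt: "\<exists>n\<in>carrier N. n \<noteq> \<one>\<^bsub>N\<^esub>"
  shows "\<exists>\<phi>. \<phi> \<in> epi N M"
proof -
  interpret M: simple_group M using f by (simp add: simple_factor_def)
  obtain n \<psi> where \<psi>: "\<psi> \<in> iso N (product_group {..<n::nat} (\<lambda>_. M))"
    using f unfolding simple_factor_def is_iso_def by blast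
  let ?P = "product_group {..<n::nat} (\<lambda>_. M)"
  have hom: "\<psi> \<in> hom N ?P" and bij: "bij_betw \<psi> (carrier N) (carrier ?P)"
    using \<psi> by (auto simp: iso_def)
  have "n \<noteq> 0"
  proof
    assume "n = 0"
    then have "carrier ?P = {\<lambda>_. undefined}" by simp
    then show False using nt bij N
      by (metis bij_betw_def group.is_monoid imageI inj_onD monoid.one_closed singletonD)
  qed
  then have n: "0 \<in> {..<n}" by simp
  have "(\<lambda>x. \<psi> x 0) \<in> hom N M"
  proof (rule homI)
    show "\<psi> x 0 \<in> carrier M" if "x \<in> carrier N" for x
      using hom_in_carrier[OF hom that] n by auto
    show "\<psi> (x \<otimes>\<^bsub>N\<^esub> y) 0 = \<psi> x 0 \<otimes>\<^bsub>M\<^esub> \<psi> y 0" if "x \<in> carrier N" "y \<in> carrier N" for x y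
      using hom_mult[OF hom that] n by simp
  qed
  moreover have "(\<lambda>x. \<psi> x 0) ` carrier N = carrier M"
  proof
    show "(\<lambda>x. \<psi> x 0) ` carrier N \<subseteq> carrier M"
      using hom_in_carrier[OF hom] n by auto
    show "carrier M \<subseteq> (\<lambda>x. \<psi> x 0) ` carrier N"
    proof
      fix m assume m: "m \<in> carrier M"
      let ?c = "\<lambda>i\<in>{..<n}. m"
      have "?c \<in> carrier ?P" using m by auto
      then have "?c \<in> \<psi> ` carrier N" using bij by (simp add: bij_betw_def)
      then obtain x where "x \<in> carrier N" "\<psi> x = ?c" by (metis imageE)
      then show "m \<in> (\<lambda>x. \<psi> x 0) ` carrier N" using n by (auto intro!: image_eqI[of _ _ x])
    qed
  qed
  ultimately show ?thesis unfolding epi_def by blast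
qed

lemma (in group) contains_minimal_normal:
  assumes "finite (carrier G)" "N \<lhd> G" "N \<noteq> {\<one>}"
  obtains K where "minimal_normal K G" "K \<subseteq> N"
proof -
  let ?Q = "\<lambda>K. K \<lhd> G \<and> K \<subseteq> N \<and> K \<noteq> {\<one>}"
  obtain K where K: "?Q K" and min: "\<And>K'. ?Q K' \<Longrightarrow> card K \<le> card K'"
    using ex_has_least_nat[of ?Q N card] assms by blast
  have "finite K" using K assms(1)
    by (meson finite_subset normal_imp_subgroup subgroup.subset)
  then have "K' = K" if "K' \<lhd> G" "K' \<subseteq> K" "K' \<noteq> {\<one>}" for K'
    using min[of K'] that K by (meson card_seteq order_trans)
  then have "minimal_normal K G" using K unfolding minimal_normal_def by blast
  then show thesis using that K by blast
qed

text \<open>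
  The commutator of an element of \<open>N\<close> and one of \<open>K\<close> lies in both subgroups.
\<close>

lemma (in group) disjoint_normals_commute:
  assumes N: "N \<lhd> G" and K: "K \<lhd> G" and disj: "N \<inter> K = {\<one>}" and x: "x \<in> N" and y: "y \<in> K"
  shows "x \<otimes> y = y \<otimes> x"
proof -
  interpret N: normal N G by fact
  interpret K: normal K G by fact
  have c: "x \<in> carrier G" "y \<in> carrier G" using x y N.subset K.subset by auto
  have 1: "x \<otimes> y \<otimes> inv x \<otimes> inv y \<in> K"
    using K.inv_op_closed2[OF c(1) y] y by auto
  have "x \<otimes> (y \<otimes> inv x \<otimes> inv y) \<in> N"
    using N.inv_op_closed2[OF c(2), of "inv x"] x by auto
  then have "x \<otimes> y \<otimes> inv x \<otimes> inv y \<in> N" using c by (simp add: m_assoc)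
  then have "x \<otimes> y \<otimes> inv x \<otimes> inv y = \<one>" using 1 disj by auto
  then have "x \<otimes> y \<otimes> inv x = y" using c by (metis inv_closed inv_equality inv_inv m_closed)
  then show ?thesis using c by (metis inv_solve_right m_closed)
qed

lemma (in group) minimal_normals_disjoint:
  assumes "minimal_normal N G" "minimal_normal K G" "N \<noteq> K"
  shows "N \<inter> K = {\<one>}"
  using assms normal_subgroup_intersect[of N K] unfolding minimal_normal_def
  by (metis Int_lower1 Int_lower2)


section \<open>Permutation groups\<close>

lemma BijGroup_simps [simp]:
  "carrier (BijGroup X) = Bij X"
  "\<one>\<^bsub>BijGroup X\<^esub> = (\<lambda>x\<in>X. x)"
  by (simp_all add: BijGroup_def)

lemma BijGroup_mult: "f \<in> Bij X \<Longrightarrow> g \<in> Bij X \<Longrightarrow> f \<otimes>\<^bsub>BijGroup X\<^esub> g = compose X f g"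
  by (simp add: BijGroup_def)

lemma Bij_eqI: "f \<in> Bij X \<Longrightarrow> g \<in> Bij X \<Longrightarrow> (\<And>x. x \<in> X \<Longrightarrow> f x = g x) \<Longrightarrow> f = g"
  by (meson Bij_imp_extensional extensionalityI)

lemma Bij_apply: "f \<in> Bij X \<Longrightarrow> x \<in> X \<Longrightarrow> f x \<in> X"
  by (auto dest: Bij_imp_funcset)

lemma group_perm_group: "subgroup F (BijGroup X) \<Longrightarrow> group (perm_group X F)"
  by (rule group.subgroup_imp_group[OF group_BijGroup])

lemma perm_group_mult:
  "subgroup F (BijGroup X) \<Longrightarrow> f \<in> F \<Longrightarrow> g \<in> F \<Longrightarrow> f \<otimes>\<^bsub>perm_group X F\<^esub> g = compose X f g"
  by (auto simp: BijGroup_def dest: subgroup.mem_carrier)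

lemma perm_group_inv_apply:
  assumes F: "subgroup F (BijGroup X)" and f: "f \<in> F" and x: "x \<in> X"
  shows "inv\<^bsub>perm_group X F\<^esub> f \<in> F" "(inv\<^bsub>perm_group X F\<^esub> f) (f x) = x" "f ((inv\<^bsub>perm_group X F\<^esub> f) x) = x"
proof -
  interpret group "perm_group X F" using F by (rule group_perm_group)
  show i: "inv\<^bsub>perm_group X F\<^esub> f \<in> F" using inv_closed[of f] f by simp
  have "compose X (inv\<^bsub>perm_group X F\<^esub> f) f = (\<lambda>x\<in>X. x)" "compose X f (inv\<^bsub>perm_group X F\<^esub> f) = (\<lambda>x\<in>X. x)"
    using l_inv[of f] r_inv[of f] f i perm_group_mult[OF F] by auto
  then show "(inv\<^bsub>perm_group X F\<^esub> f) (f x) = x" "f ((inv\<^bsub>perm_group X F\<^esub> f) x) = x"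
    using x by (metis compose_eq restrict_apply')+
qed

lemma quasi_primitive_transitive:
  assumes qp: "quasi_primitive X F" and N: "N \<lhd> perm_group X F" and nt: "N \<noteq> {\<one>\<^bsub>perm_group X F\<^esub>}"
    and "x \<in> X" "y \<in> X"
  obtains n where "n \<in> N" "n x = y"
proof -
  have "transitive_action (perm_group X N) X (\<lambda>f. f)" using qp N nt unfolding quasi_primitive_def by blast
  from transitive_action.unique_orbit[OF this assms(4,5)] show thesis using that by auto
qed

text \<open>
  Two distinct minimal normal subgroups \<open>N\<close> and \<open>K\<close> commute and are both transitive, so both are regular. Fix a
  point \<open>o'\<close>. Sending \<open>k \<in> K\<close> to the element \<open>n \<in> N\<close> with \<open>n o' = k\<inverse> o'\<close> is then a homomorphism: the inverse
  compensates for the reversal of order that is caused by moving elements of \<open>N\<close> past elements of \<open>K\<close>.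
  Surjectivity is all that is needed to carry a simple quotient of \<open>N\<close> over to \<open>K\<close>.
\<close>

lemma quasi_primitive_minimal_normal_epi:
  assumes F: "subgroup F (BijGroup X)" and qp: "quasi_primitive X F"
    and N: "minimal_normal N (perm_group X F)" and K: "minimal_normal K (perm_group X F)"
  shows "\<exists>\<theta>. \<theta> \<in> epi (perm_group X K) (perm_group X N)"
proof (cases "N = K")
  case True
  have "(\<lambda>x. x) \<in> epi (perm_group X K) (perm_group X N)" using True by (simp add: epi_def hom_def)
  then show ?thesis by blast
next
  case False
  interpret group "perm_group X F" using F by (rule group_perm_group)
  let ?G = "perm_group X F"
  have Nn: "N \<lhd> ?G" "N \<noteq> {\<one>\<^bsub>?G\<^esub>}" and Kn: "K \<lhd> ?G" "K \<noteq> {\<one>\<^bsub>?G\<^esub>}"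
    using N K by (auto simp: minimal_normal_def)
  have sF: "N \<subseteq> F" "K \<subseteq> F" using subgroup.subset[OF normal_imp_subgroup[OF Nn(1)]] subgroup.subset[OF normal_imp_subgroup[OF Kn(1)]] by simp_all
  have FB: "F \<subseteq> Bij X" using subgroup.subset[OF F] by simp
  have sB: "subgroup N (BijGroup X)" "subgroup K (BijGroup X)"
    using Nn Kn F normal_imp_subgroup group.incl_subgroup[OF group_BijGroup] by blast+
  have disj: "N \<inter> K = {\<one>\<^bsub>?G\<^esub>}" using minimal_normals_disjoint[OF N K False] .
  have comm: "n (k x) = k (n x)" if "n \<in> N" "k \<in> K" "x \<in> X" for n k x
  proof -
    have "compose X n k = compose X k n"
      using disjoint_normals_commute[OF Nn(1) Kn(1) disj that(1,2)] that sF perm_group_mult[OF F] by (metis subsetD)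
    then show ?thesis using that(3) by (metis compose_eq)
  qed
  obtain f where f: "f \<in> N" "f \<noteq> \<one>\<^bsub>?G\<^esub>"
    using Nn(2) subgroup.one_closed[OF normal_imp_subgroup[OF Nn(1)]] by blast
  have appX: "f x \<in> X" if "f \<in> F" "x \<in> X" for f x using Bij_apply[of f X x] that FB by auto
  have "\<exists>o'. o' \<in> X"
  proof (rule ccontr)
    assume "\<not> ?thesis"
    moreover have "f \<in> Bij X" using f sF FB by blast
    ultimately have "f = (\<lambda>x\<in>X. x)" by (intro Bij_eqI[OF _ id_Bij]) auto
    then show False using f by simp
  qed
  then obtain o' where o': "o' \<in> X" ..
  \<comment> \<open>Either of the two subgroups is semiregular, because the other one commutes with it and is transitive.\<close>
  have semireg: "n = n'" if "n \<in> N" "n' \<in> N" "n o' = n' o'" for n n'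
  proof (rule Bij_eqI)
    show "n \<in> Bij X" "n' \<in> Bij X" using that sF FB by auto
    fix x assume "x \<in> X"
    then obtain k where "k \<in> K" "k o' = x" by (rule quasi_primitive_transitive[OF qp Kn o'])
    then show "n x = n' x" using that comm o' by metis
  qed
  define iv where "iv f = inv\<^bsub>perm_group X F\<^esub> f" for f
  have ivK: "iv k \<in> K" if "k \<in> K" for k
    unfolding iv_def using subgroup.m_inv_closed[OF normal_imp_subgroup[OF Kn(1)]] that .
  have iv: "iv k (k x) = x" "k (iv k x) = x" if "k \<in> K" "x \<in> X" for k x
    unfolding iv_def using perm_group_inv_apply[OF F] that sF by blast+
  have ex: "\<exists>n. n \<in> N \<and> n o' = iv k o'" if "k \<in> K" for k
  proof -
    have "iv k o' \<in> X" using appX[OF subsetD[OF sF(2) ivK[OF that]] o'] .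
    then show ?thesis using quasi_primitive_transitive[OF qp Nn o'] by metis
  qed
  define \<theta> where "\<theta> k = (SOME n. n \<in> N \<and> n o' = iv k o')" for k
  have \<theta>: "\<theta> k \<in> N" "\<theta> k o' = iv k o'" if "k \<in> K" for k
    using someI_ex[OF ex[OF that]] unfolding \<theta>_def by auto
  have mN: "n \<otimes>\<^bsub>perm_group X N\<^esub> n' = compose X n n'" "compose X n n' \<in> N" if "n \<in> N" "n' \<in> N" for n n'
    using perm_group_mult[OF sB(1) that] subgroup.m_closed[OF sB(1) that] BijGroup_mult that sF FB by auto
  have mK: "n \<otimes>\<^bsub>perm_group X K\<^esub> n' = compose X n n'" "compose X n n' \<in> K" if "n \<in> K" "n' \<in> K" for n n'
    using perm_group_mult[OF sB(2) that] subgroup.m_closed[OF sB(2) that] BijGroup_mult that sF FB by auto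
  have "\<theta> \<in> hom (perm_group X K) (perm_group X N)"
  proof (rule homI)
    show "\<theta> k \<in> carrier (perm_group X N)" if "k \<in> carrier (perm_group X K)" for k using \<theta> that by simp
    fix k k' assume "k \<in> carrier (perm_group X K)" "k' \<in> carrier (perm_group X K)"
    then have k: "k \<in> K" "k' \<in> K" by auto
    have kk: "compose X k k' \<in> K" using mK k by simp
    have ivX: "iv k o' \<in> X" "iv k' (iv k o') \<in> X" using appX[OF subsetD[OF sF(2) ivK]] k o' by auto
    have "iv (compose X k k') o' = iv (compose X k k') (compose X k k' (iv k' (iv k o')))"
      using iv(2)[OF k(2) ivX(1)] iv(2)[OF k(1) o'] ivX by (simp add: compose_eq)
    then have 1: "iv (compose X k k') o' = iv k' (iv k o')" using iv(1)[OF kk ivX(2)] by simp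
    have "\<theta> (compose X k k') = compose X (\<theta> k) (\<theta> k')"
    proof (rule semireg)
      have "compose X (\<theta> k) (\<theta> k') o' = \<theta> k (iv k' o')" using \<theta> k o' by (simp add: compose_eq)
      also have "\<dots> = iv k' (\<theta> k o')" using comm \<theta> k ivK o' by blast
      finally show "\<theta> (compose X k k') o' = compose X (\<theta> k) (\<theta> k') o'" using \<theta> k kk 1 by simp
    qed (use \<theta> k kk mN in auto)
    then show "\<theta> (k \<otimes>\<^bsub>perm_group X K\<^esub> k') = \<theta> k \<otimes>\<^bsub>perm_group X N\<^esub> \<theta> k'" using mN mK \<theta> k by auto
  qed
  moreover have "\<theta> ` carrier (perm_group X K) = carrier (perm_group X N)"
  proof (intro equalityI subsetI)
    show "n \<in> carrier (perm_group X N)" if "n \<in> \<theta> ` carrier (perm_group X K)" for n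
      using that \<theta>(1) by (elim imageE) simp
    fix n assume "n \<in> carrier (perm_group X N)"
    then have n: "n \<in> N" by simp
    then have "n o' \<in> X" using sF appX o' by blast
    from this o' obtain k where k: "k \<in> K" "k (n o') = o'" by (rule quasi_primitive_transitive[OF qp Kn])
    then have "iv k o' = n o'" using iv(1)[OF k(1) \<open>n o' \<in> X\<close>] k(2) by simp
    then have "\<theta> k o' = n o'" by (simp only: \<theta>(2)[OF k(1)])
    then have "\<theta> k = n" by (rule semireg[OF \<theta>(1)[OF k(1)] n])
    moreover have "\<theta> k \<in> \<theta> ` carrier (perm_group X K)" by (rule imageI) (simp add: k(1))
    ultimately show "n \<in> \<theta> ` carrier (perm_group X K)" by (simp only:)
  qed
  ultimately have "\<theta> \<in> epi (perm_group X K) (perm_group X N)" by (simp add: epi_def)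
  then show ?thesis by (rule exI[where x = \<theta>])
qed

section \<open>Balls and automorphisms of a locally finite tree\<close>

lemma locally_finite_tree_facts:
  assumes "locally_finite_tree T"
  shows arcs_verts: "(u, v) \<in> parcs T \<Longrightarrow> u \<in> pverts T \<and> v \<in> pverts T"
    and arcs_sym: "(u, v) \<in> parcs T \<Longrightarrow> (v, u) \<in> parcs T"
    and finite_edges_from: "x \<in> pverts T \<Longrightarrow> finite (edges_from T x)"
    and tree_connected: "u \<in> pverts T \<Longrightarrow> v \<in> pverts T \<Longrightarrow> (u, v) \<in> (parcs T)\<^sup>*"
proof -
  interpret pair_bidirected_digraph T
    using assms unfolding locally_finite_tree_def undirected_tree_def by blast
  show "(u, v) \<in> parcs T \<Longrightarrow> u \<in> pverts T \<and> v \<in> pverts T"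
    using in_arcsD1 in_arcsD2 by blast
  have sym: "symmetric (with_proj T)" by (rule pair_sym_arcs)
  then show "(u, v) \<in> parcs T \<Longrightarrow> (v, u) \<in> parcs T"
    unfolding symmetric_def by (auto dest: symD)
  show "x \<in> pverts T \<Longrightarrow> finite (edges_from T x)"
    using assms unfolding locally_finite_tree_def by blast
  assume uv: "u \<in> pverts T" "v \<in> pverts T"
  have "Digraph_Component.connected (with_proj T)"
    using assms unfolding locally_finite_tree_def undirected_tree_def by blast
  then have "strongly_connected (with_proj T)"
    using symmetric_connected_imp_strongly_connected sym by blast
  then have "u \<rightarrow>\<^sup>*\<^bsub>with_proj T\<^esub> v"
    using uv unfolding strongly_connected_def by simp
  then show "(u, v) \<in> (parcs T)\<^sup>*"
    using reachable_rtranclI by fastforce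
qed

lemma in_edges_from: "e \<in> edges_from T x \<longleftrightarrow> e \<in> parcs T \<and> fst e = x"
  by (auto simp: out_arcs_def)

definition vertex_ball :: "'a pair_pre_digraph \<Rightarrow> nat \<Rightarrow> 'a \<Rightarrow> 'a set" where
  "vertex_ball T n x = ((parcs T \<union> Id) ^^ n) `` {x}"

lemma vertex_ball_0: "vertex_ball T 0 x = {x}" by (simp add: vertex_ball_def)

lemma vertex_ball_1: "vertex_ball T 1 x = insert x {w. (x, w) \<in> parcs T}"
  by (auto simp: vertex_ball_def)

lemma vertex_ball_trans:
  "y \<in> vertex_ball T m x \<Longrightarrow> z \<in> vertex_ball T n y \<Longrightarrow> z \<in> vertex_ball T (m + n) x"
  by (auto simp: vertex_ball_def relpow_add)

lemma centre_in_vertex_ball: "x \<in> vertex_ball T n x"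
proof -
  have "(x, x) \<in> (parcs T \<union> Id) ^^ n" by (induction n) auto
  then show ?thesis by (simp add: vertex_ball_def)
qed

lemma vertex_ball_mono: "m \<le> n \<Longrightarrow> vertex_ball T m x \<subseteq> vertex_ball T n x"
  using vertex_ball_trans[OF _ centre_in_vertex_ball, of _ T m x "n - m"] by auto

lemma sym_relpow: "sym R \<Longrightarrow> sym (R ^^ n)"
  by (induction n) (simp_all add: sym_conv_converse_eq converse_relcomp relpow_commute)

context
  fixes T assumes T: "locally_finite_tree T"
begin

lemma vertex_ball_sym:
  assumes "y \<in> vertex_ball T n x" shows "x \<in> vertex_ball T n y"
proof -
  have "sym (parcs T \<union> Id)" by (rule symI) (auto dest: arcs_sym[OF T])
  then have "sym ((parcs T \<union> Id) ^^ n)"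
    by (rule sym_relpow)
  then show ?thesis using assms by (auto simp: vertex_ball_def dest: symD)
qed

lemma vertex_ball_verts:
  assumes "x \<in> pverts T" shows "vertex_ball T n x \<subseteq> pverts T"
proof -
  have "(x, y) \<in> (parcs T \<union> Id) ^^ n \<Longrightarrow> y \<in> pverts T" for y
    by (induction n arbitrary: y) (use assms arcs_verts[OF T] in auto)
  then show ?thesis by (auto simp: vertex_ball_def)
qed

lemma finite_neighbours: "finite {w. (x, w) \<in> parcs T}"
proof (cases "x \<in> pverts T")
  case True
  have "{w. (x, w) \<in> parcs T} \<subseteq> snd ` edges_from T x" by (force simp: in_edges_from)
  then show ?thesis using finite_edges_from[OF T True] finite_surj by blast
next
  case False
  then have "{w. (x, w) \<in> parcs T} = {}" using arcs_verts[OF T] by blast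
  then show ?thesis by simp
qed

lemma finite_vertex_ball: "finite (vertex_ball T n x)"
proof (induction n)
  case (Suc n)
  have "vertex_ball T (Suc n) x = (\<Union>y\<in>vertex_ball T n x. vertex_ball T 1 y)"
    by (auto simp: vertex_ball_def)
  then show ?case using Suc by (simp add: vertex_ball_1[unfolded One_nat_def] finite_neighbours)
qed (simp add: vertex_ball_0)

lemma vertex_ball_exhausts:
  assumes "x \<in> pverts T" "y \<in> pverts T" obtains n where "y \<in> vertex_ball T n x"
proof -
  have "(x, y) \<in> (parcs T)\<^sup>*" by (rule tree_connected[OF T assms])
  then have "(x, y) \<in> (parcs T \<union> Id)\<^sup>*" by (rule rtrancl_mono[THEN subsetD, rotated]) simp
  then obtain n where "(x, y) \<in> (parcs T \<union> Id) ^^ n" using rtrancl_power by blast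
  then show thesis using that by (simp add: vertex_ball_def)
qed

text \<open>
  Connectedness in the form in which it is used throughout: a property that spreads to neighbours spreads
  everywhere.
\<close>

lemma closed_under_neighbours:
  assumes "u \<in> Z" "u \<in> pverts T" and step: "\<And>v w. v \<in> Z \<Longrightarrow> (v, w) \<in> parcs T \<Longrightarrow> w \<in> Z"
  shows "pverts T \<subseteq> Z"
proof
  fix v assume "v \<in> pverts T"
  from tree_connected[OF T assms(2) this] show "v \<in> Z"
    by induction (use assms in auto)
qed

lemma subgroup_automorphisms: "subgroup (automorphisms T) (BijGroup (pverts T))"
proof -
  interpret B: group "BijGroup (pverts T)" by (rule group_BijGroup)
  let ?V = "pverts T"
  show ?thesis
  proof (rule B.subgroupI)
    show "automorphisms T \<subseteq> carrier (BijGroup ?V)" by (auto simp: automorphisms_def)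
    have "(\<lambda>v\<in>?V. v) \<in> automorphisms T" by (auto simp: automorphisms_def id_Bij)
    then show "automorphisms T \<noteq> {}" by blast
    show "inv\<^bsub>BijGroup ?V\<^esub> g \<in> automorphisms T" if g: "g \<in> automorphisms T" for g
    proof -
      let ?i = "inv\<^bsub>BijGroup ?V\<^esub> g"
      have gB: "g \<in> Bij ?V" and iB: "?i \<in> Bij ?V" using g B.inv_closed[of g] by (auto simp: automorphisms_def)
      have "compose ?V g ?i = (\<lambda>v\<in>?V. v)" using B.r_inv[of g] gB iB by (simp add: BijGroup_mult)
      then have gi: "g (?i v) = v" if "v \<in> ?V" for v using that compose_eq[of v ?V g ?i] by simp
      have pres: "(g u, g v) \<in> parcs T \<longleftrightarrow> (u, v) \<in> parcs T" if "u \<in> ?V" "v \<in> ?V" for u v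
        using g that unfolding automorphisms_def by blast
      have "(?i u, ?i v) \<in> parcs T \<longleftrightarrow> (u, v) \<in> parcs T" if "u \<in> ?V" "v \<in> ?V" for u v
        using that gi Bij_apply[OF iB] pres[of "?i u" "?i v"] by simp
      then show ?thesis using iB unfolding automorphisms_def by blast
    qed
    show "g \<otimes>\<^bsub>BijGroup ?V\<^esub> h \<in> automorphisms T" if "g \<in> automorphisms T" "h \<in> automorphisms T" for g h
      using that by (auto simp: automorphisms_def BijGroup_mult compose_Bij compose_eq Bij_apply)
  qed
qed

lemma group_aut_group: "group (aut_group T)"
  by (rule group_perm_group[OF subgroup_automorphisms])

lemma aut_subgroup_Bij: "subgroup G (aut_group T) \<Longrightarrow> subgroup G (BijGroup (pverts T))"
  by (rule group.incl_subgroup[OF group_BijGroup subgroup_automorphisms])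

lemma aut_subgroup_automorphisms: "subgroup G (aut_group T) \<Longrightarrow> G \<subseteq> automorphisms T"
  using subgroup.subset by fastforce

end

section \<open>Groups acting on a tree\<close>

text \<open>
  The group \<open>L\<close> is kept apart from its image in the automorphism group because one discrete group acts on two
  trees, faithfully on the pair only, and the two trees exchange their roles.
\<close>

locale tree_action =
  fixes L (structure) and T :: "'a pair_pre_digraph" and \<phi>
  assumes tree: "locally_finite_tree T"
    and action: "group_hom L (aut_group T) \<phi>"
begin

sublocale group L using action by (rule group_hom.axioms)

abbreviation "V \<equiv> pverts T"

lemma act_aut: "g \<in> carrier L \<Longrightarrow> \<phi> g \<in> automorphisms T"
  using group_hom.hom_closed[OF action] by simp

lemma act_Bij: "g \<in> carrier L \<Longrightarrow> \<phi> g \<in> Bij V"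
  using act_aut by (auto simp: automorphisms_def)

lemma act_closed: "g \<in> carrier L \<Longrightarrow> v \<in> V \<Longrightarrow> \<phi> g v \<in> V"
  using Bij_apply[OF act_Bij] .

lemma act_one: "v \<in> V \<Longrightarrow> \<phi> \<one> v = v"
  using group_hom.hom_one[OF action] by simp

lemma act_mult: "g \<in> carrier L \<Longrightarrow> h \<in> carrier L \<Longrightarrow> v \<in> V \<Longrightarrow> \<phi> (g \<otimes> h) v = \<phi> g (\<phi> h v)"
  using group_hom.hom_mult[OF action, of g h] by (simp add: BijGroup_mult act_Bij compose_eq)

lemma act_inv: "g \<in> carrier L \<Longrightarrow> v \<in> V \<Longrightarrow> \<phi> (inv g) (\<phi> g v) = v"
  "g \<in> carrier L \<Longrightarrow> v \<in> V \<Longrightarrow> \<phi> g (\<phi> (inv g) v) = v"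
  by (metis act_mult act_one inv_closed l_inv r_inv)+

lemma act_arc: "g \<in> carrier L \<Longrightarrow> (u, v) \<in> parcs T \<Longrightarrow> (\<phi> g u, \<phi> g v) \<in> parcs T"
  using act_aut[of g] arcs_verts[OF tree, of u v] by (auto simp: automorphisms_def)

lemma act_ball:
  assumes "g \<in> carrier L" "x \<in> V" "y \<in> vertex_ball T n x"
  shows "\<phi> g y \<in> vertex_ball T n (\<phi> g x)"
proof -
  have "(x, y) \<in> (parcs T \<union> Id) ^^ n \<Longrightarrow> (\<phi> g x, \<phi> g y) \<in> (parcs T \<union> Id) ^^ n"
    by (induction n arbitrary: y) (use act_arc[OF assms(1)] in auto)
  then show ?thesis using assms by (auto simp: vertex_ball_def)
qed

definition stab :: "'a \<Rightarrow> 'b set" where "stab x = {g \<in> carrier L. \<phi> g x = x}"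

definition fixator :: "'a set \<Rightarrow> 'b set" where "fixator P = {g \<in> carrier L. \<forall>p\<in>P. \<phi> g p = p}"

text \<open>
  On the stabilizer of \<open>x\<close> this is the homomorphism to the symmetric group on the edges at \<open>x\<close> whose image is
  the local permutation group of the action.
\<close>

definition loc :: "'a \<Rightarrow> 'b \<Rightarrow> 'a \<times> 'a \<Rightarrow> 'a \<times> 'a" where
  "loc x g = restrict (map_prod (\<phi> g) (\<phi> g)) (edges_from T x)"

lemma subgroup_fixator:
  assumes "P \<subseteq> V" shows "subgroup (fixator P) L"
proof (rule subgroupI)
  show "fixator P \<subseteq> carrier L" by (auto simp: fixator_def)
  show "fixator P \<noteq> {}" using act_one assms by (auto simp: fixator_def)
  show "inv g \<in> fixator P" if "g \<in> fixator P" for g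
    using that act_inv(1)[of g] assms by (force simp: fixator_def)
  show "g \<otimes> h \<in> fixator P" if "g \<in> fixator P" "h \<in> fixator P" for g h
    using that assms by (auto simp: fixator_def act_mult subset_iff)
qed

lemma stabD: "g \<in> stab x \<Longrightarrow> g \<in> carrier L" "g \<in> stab x \<Longrightarrow> \<phi> g x = x"
  by (simp_all add: stab_def)

lemma stab_fixator: "stab x = fixator {x}" by (auto simp: stab_def fixator_def)

lemma subgroup_stab: "x \<in> V \<Longrightarrow> subgroup (stab x) L"
  unfolding stab_fixator by (rule subgroup_fixator) simp

lemma loc_apply: "(x, w) \<in> parcs T \<Longrightarrow> g \<in> stab x \<Longrightarrow> loc x g (x, w) = (x, \<phi> g w)"
  by (simp add: loc_def in_edges_from stab_def)

lemma loc_hom: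
  assumes x: "x \<in> V" shows "loc x \<in> hom (L\<lparr>carrier := stab x\<rparr>) (BijGroup (edges_from T x))"
proof -
  let ?E = "edges_from T x"
  interpret S: subgroup "stab x" L by (rule subgroup_stab[OF x])
  have eV: "snd e \<in> V" "(x, snd e) \<in> parcs T" and eE: "e = (x, snd e)" if "e \<in> ?E" for e
    using that arcs_verts[OF tree, of "fst e" "snd e"] by (auto simp: in_edges_from prod_eq_iff)
  have app: "loc x g e = (x, \<phi> g (snd e))" "loc x g e \<in> ?E" if "g \<in> stab x" "e \<in> ?E" for g e
  proof -
    show *: "loc x g e = (x, \<phi> g (snd e))" using loc_apply[OF eV(2)[OF that(2)] that(1)] by (subst eE[OF that(2)])
    have c: "g \<in> carrier L" "\<phi> g x = x" using stabD[OF that(1)] .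
    have "(\<phi> g x, \<phi> g (snd e)) \<in> parcs T" by (rule act_arc[OF c(1) eV(2)[OF that(2)]])
    then show "loc x g e \<in> ?E" unfolding * in_edges_from c(2) by simp
  qed
  have mult: "loc x (g \<otimes> h) e = loc x g (loc x h e)" if "g \<in> stab x" "h \<in> stab x" "e \<in> ?E" for g h e
    using that app(1)[OF _ that(3)] app(1)[OF that(1) app(2)[OF that(2,3)]] eV(1) act_mult[of g h "snd e"] by simp
  have one: "loc x \<one> e = e" if "e \<in> ?E" for e
    using app(1)[OF S.one_closed that] act_one[OF eV(1)[OF that]] eE[OF that] by argo
  have Bij: "loc x g \<in> Bij ?E" if g: "g \<in> stab x" for g
  proof -
    have i: "inv g \<in> stab x" using g by simp
    have "bij_betw (loc x g) ?E ?E"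
    proof (rule bij_betw_byWitness[where f' = "loc x (inv g)"])
      have c: "g \<in> carrier L" using stabD(1)[OF g] .
      show "\<forall>e\<in>?E. loc x (inv g) (loc x g e) = e"
        using mult[OF i g] one c by simp
      show "\<forall>e\<in>?E. loc x g (loc x (inv g) e) = e"
        using mult[OF g i] one c by simp
    qed (use app(2) g i in auto)
    then show ?thesis by (auto simp: Bij_def loc_def)
  qed
  show ?thesis
  proof (rule homI)
    fix g h assume "g \<in> carrier (L\<lparr>carrier := stab x\<rparr>)" "h \<in> carrier (L\<lparr>carrier := stab x\<rparr>)"
    then have gh: "g \<in> stab x" "h \<in> stab x" "g \<otimes> h \<in> stab x" by auto
    have "loc x (g \<otimes> h) = compose ?E (loc x g) (loc x h)"
      by (rule Bij_eqI[OF Bij[OF gh(3)] compose_Bij[OF Bij[OF gh(1)] Bij[OF gh(2)]]])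
        (simp add: mult gh compose_eq)
    then show "loc x (g \<otimes>\<^bsub>L\<lparr>carrier := stab x\<rparr>\<^esub> h) = loc x g \<otimes>\<^bsub>BijGroup ?E\<^esub> loc x h"
      using gh Bij by (simp add: BijGroup_mult)
  qed (use Bij in auto)
qed

lemma loc_group_hom:
  assumes x: "x \<in> V" shows "group_hom (L\<lparr>carrier := stab x\<rparr>) (BijGroup (edges_from T x)) (loc x)"
  using loc_hom[OF x] subgroup_imp_group[OF subgroup_stab[OF x]] group_BijGroup
  by (simp add: group_hom_def group_hom_axioms_def)

lemma loc_eq_iff:
  assumes "g \<in> stab x" "h \<in> stab x"
  shows "loc x g = loc x h \<longleftrightarrow> (\<forall>w. (x, w) \<in> parcs T \<longrightarrow> \<phi> g w = \<phi> h w)"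
proof
  assume eq: "loc x g = loc x h"
  show "\<forall>w. (x, w) \<in> parcs T \<longrightarrow> \<phi> g w = \<phi> h w"
    using loc_apply[OF _ assms(1)] loc_apply[OF _ assms(2)] eq by fastforce
next
  assume r: "\<forall>w. (x, w) \<in> parcs T \<longrightarrow> \<phi> g w = \<phi> h w"
  have "map_prod (\<phi> g) (\<phi> g) e = map_prod (\<phi> h) (\<phi> h) e" if "e \<in> edges_from T x" for e
    using that r assms by (cases e) (auto simp: in_edges_from stab_def)
  then show "loc x g = loc x h" unfolding loc_def by (rule restrict_ext)
qed

lemma loc_trivial_iff:
  assumes "x \<in> V" "g \<in> stab x"
  shows "loc x g = \<one>\<^bsub>BijGroup (edges_from T x)\<^esub> \<longleftrightarrow> (\<forall>w. (x, w) \<in> parcs T \<longrightarrow> \<phi> g w = w)"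
proof -
  interpret S: subgroup "stab x" L by (rule subgroup_stab[OF assms(1)])
  interpret H: group_hom "L\<lparr>carrier := stab x\<rparr>" "BijGroup (edges_from T x)" "loc x"
    by (rule loc_group_hom[OF assms(1)])
  have "loc x \<one> = \<one>\<^bsub>BijGroup (edges_from T x)\<^esub>" using H.hom_one by simp
  then show ?thesis using loc_eq_iff[OF assms(2) S.one_closed] act_one arcs_verts[OF tree] by auto
qed

text \<open>
  On a path from a fixed vertex to a moved one there is a last fixed vertex before the first moved one.
\<close>

lemma moved_neighbour:
  assumes u: "u \<in> V" "\<phi> g u = u" and v: "v \<in> V" "\<phi> g v \<noteq> v"
  obtains x w where "x \<in> V" "\<phi> g x = x" "(x, w) \<in> parcs T" "\<phi> g w \<noteq> w"
proof -
  have "\<exists>x w. \<phi> g x = x \<and> (x, w) \<in> parcs T \<and> \<phi> g w \<noteq> w"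
  proof (rule ccontr)
    assume "\<not> ?thesis"
    then have "V \<subseteq> {v. \<phi> g v = v}"
      by (intro closed_under_neighbours[OF tree _ u(1)]) (use u in auto)
    then show False using v by auto
  qed
  then show thesis using that arcs_verts[OF tree] by metis
qed

end

section \<open>Simple quotients of finite groups acting on a tree\<close>

lemma (in group) normal_in_subgroup:
  assumes H: "subgroup H G" and A: "subgroup A G" and sub: "A \<subseteq> H"
    and conj: "\<And>h a. h \<in> H \<Longrightarrow> a \<in> A \<Longrightarrow> h \<otimes> a \<otimes> inv h \<in> A"
  shows "A \<lhd> G\<lparr>carrier := H\<rparr>"
proof -
  interpret H: group "G\<lparr>carrier := H\<rparr>" by (rule subgroup_imp_group[OF H])
  show ?thesis
  proof (rule H.normal_invI)
    show "subgroup A (G\<lparr>carrier := H\<rparr>)" by (rule subgroup_incl[OF A H sub])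
    show "h \<otimes>\<^bsub>G\<lparr>carrier := H\<rparr>\<^esub> a \<otimes>\<^bsub>G\<lparr>carrier := H\<rparr>\<^esub> inv\<^bsub>G\<lparr>carrier := H\<rparr>\<^esub> h \<in> A"
      if "h \<in> carrier (G\<lparr>carrier := H\<rparr>)" "a \<in> A" for h a
      using conj[of h a] that m_inv_consistent[OF H, of h] by simp
  qed
qed

context tree_action
begin

lemma loc_group_hom_on:
  assumes x: "x \<in> V" and A: "subgroup A L" "A \<subseteq> stab x"
  shows "group_hom (L\<lparr>carrier := A\<rparr>) (BijGroup (edges_from T x)) (loc x)"
proof -
  have "loc x \<in> hom (L\<lparr>carrier := A\<rparr>) (BijGroup (edges_from T x))"
    using loc_hom[OF x] A(2) by (auto simp: hom_def)
  then show ?thesis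
    using subgroup_imp_group[OF A(1)] group_BijGroup by (simp add: group_hom_def group_hom_axioms_def)
qed

text \<open>
  The restriction on composition factors imposed by the local actions. As \<open>A\<close> fixes the star of \<open>y\<close> but moves
  something, there is an edge \<open>(z, w)\<close> fixed by \<open>A\<close> at which some further neighbour of \<open>z\<close> is moved. The kernel
  \<open>K\<close> of the action on the star of \<open>z\<close> is a smaller normal subgroup, and by simplicity \<open>\<alpha>\<close> maps it either to the
  trivial group, so that \<open>\<alpha>\<close> factors through the local action at \<open>z\<close>, or onto \<open>M\<close>, so that \<open>A\<close> can be replaced
  by \<open>K\<close>.
\<close>

lemma simple_quotient_seen_at_edge:
  assumes M: "simple_group M" and y: "y \<in> V"
    and "subgroup A L" "finite A" "A \<subseteq> fixator (vertex_ball T 1 y)"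
    and "\<And>a. a \<in> A \<Longrightarrow> \<forall>v\<in>V. \<phi> a v = v \<Longrightarrow> a = \<one>"
    and "\<alpha> \<in> epi (L\<lparr>carrier := A\<rparr>) M"
  shows "\<exists>B z w. subgroup B L \<and> B \<subseteq> A \<and> (z, w) \<in> parcs T \<and> B \<subseteq> fixator {z, w} \<and>
    \<alpha> \<in> epi (L\<lparr>carrier := B\<rparr>) M \<and>
    (\<forall>b\<in>B. loc z b = \<one>\<^bsub>BijGroup (edges_from T z)\<^esub> \<longrightarrow> \<alpha> b = \<one>\<^bsub>M\<^esub>)"
  using assms(3-)
proof (induction "card A" arbitrary: A rule: less_induct)
  case less
  note A = less.prems(1) and fin = less.prems(2) and fix_ball = less.prems(3)
    and faithful = less.prems(4) and \<alpha> = less.prems(5)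
  interpret M: simple_group M by (rule M)
  have homA: "group_hom (L\<lparr>carrier := A\<rparr>) M \<alpha>"
    using \<alpha> subgroup_imp_group[OF A] M.group_axioms by (simp add: group_hom_def group_hom_axioms_def epi_def)
  have imgA: "\<alpha> ` A = carrier M" using \<alpha> by (simp add: epi_def)
  let ?fixed = "\<lambda>v. \<forall>a\<in>A. \<phi> a v = v"
  have "\<exists>v\<in>V. \<not> ?fixed v"
  proof (rule ccontr)
    assume "\<not> ?thesis"
    then have "A \<subseteq> {\<one>}" using faithful by auto
    then have "\<alpha> ` A \<subseteq> {\<one>\<^bsub>M\<^esub>}" using group_hom.hom_one[OF homA] by auto
    then show False using imgA M.simple_not_triv M.one_closed by auto
  qed
  then obtain v where v: "v \<in> V" "\<not> ?fixed v" by auto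
  have "\<exists>z w. (z, w) \<in> parcs T \<and> ?fixed z \<and> ?fixed w \<and> (\<exists>w'. (z, w') \<in> parcs T \<and> \<not> ?fixed w')"
  proof (rule ccontr)
    assume no: "\<not> ?thesis"
    have "V \<subseteq> {v. ?fixed v \<and> (\<forall>w. (v, w) \<in> parcs T \<longrightarrow> ?fixed w)}"
    proof (rule closed_under_neighbours[OF tree _ y])
      show "y \<in> {v. ?fixed v \<and> (\<forall>w. (v, w) \<in> parcs T \<longrightarrow> ?fixed w)}"
        using fix_ball unfolding vertex_ball_1 fixator_def by auto
    next
      fix v w assume vw: "v \<in> {v. ?fixed v \<and> (\<forall>w. (v, w) \<in> parcs T \<longrightarrow> ?fixed w)}" "(v, w) \<in> parcs T"
      have "(w, v) \<in> parcs T" "?fixed w" "?fixed v" using vw arcs_sym[OF tree] by auto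
      then have "\<forall>w'. (w, w') \<in> parcs T \<longrightarrow> ?fixed w'" using no by meson
      then show "w \<in> {v. ?fixed v \<and> (\<forall>w. (v, w) \<in> parcs T \<longrightarrow> ?fixed w)}" using \<open>?fixed w\<close> by simp
    qed
    then show False using v by auto
  qed
  then obtain z w w' a where zw: "(z, w) \<in> parcs T" "?fixed z" "?fixed w"
    and w': "(z, w') \<in> parcs T" "a \<in> A" "\<phi> a w' \<noteq> w'" by auto
  have zV: "z \<in> V" using arcs_verts[OF tree zw(1)] by simp
  have AL: "A \<subseteq> carrier L" using subgroup.subset[OF A] .
  have Az: "A \<subseteq> stab z" "A \<subseteq> fixator {z, w}" using zw AL by (auto simp: stab_def fixator_def)
  define E where "E = BijGroup (edges_from T z)"
  interpret H: group_hom "L\<lparr>carrier := A\<rparr>" E "loc z"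
    unfolding E_def by (rule loc_group_hom_on[OF zV A Az(1)])
  define K where "K = kernel (L\<lparr>carrier := A\<rparr>) E (loc z)"
  have K_iff: "b \<in> K \<longleftrightarrow> b \<in> A \<and> loc z b = \<one>\<^bsub>E\<^esub>" for b
    by (simp add: K_def kernel_def)
  have Kn: "K \<lhd> L\<lparr>carrier := A\<rparr>" unfolding K_def by (rule H.normal_kernel)
  have Ks: "subgroup K L" by (rule incl_subgroup[OF A normal_imp_subgroup[OF Kn]])
  have "loc z a \<noteq> \<one>\<^bsub>E\<^esub>"
    unfolding E_def using loc_trivial_iff[OF zV subsetD[OF Az(1) w'(2)]] w' by auto
  then have "K \<subset> A" using K_iff w'(2) by auto
  then have less_card: "card K < card A" by (rule psubset_card_mono[OF fin])
  have "\<alpha> ` K \<lhd> M"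
    by (rule normal.surj_hom_normal_subgroup[OF Kn homA]) (simp add: imgA)
  then consider "\<alpha> ` K = carrier M" | "\<alpha> ` K = {\<one>\<^bsub>M\<^esub>}"
    using M.no_real_normal_subgroup by auto
  then show ?case
  proof cases
    case 1
    have KA: "K \<subseteq> A" using \<open>K \<subset> A\<close> by auto
    have "\<alpha> \<in> epi (L\<lparr>carrier := K\<rparr>) M"
      using \<alpha> KA 1 by (simp add: epi_def hom_def Pi_iff subset_iff)
    moreover have "finite K" using fin KA by (rule rev_finite_subset)
    moreover have "K \<subseteq> fixator (vertex_ball T 1 y)" using KA fix_ball by (rule order_trans)
    moreover have "\<And>a. a \<in> K \<Longrightarrow> \<forall>v\<in>V. \<phi> a v = v \<Longrightarrow> a = \<one>" using KA faithful by auto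
    ultimately obtain B z w where "subgroup B L \<and> B \<subseteq> K \<and> (z, w) \<in> parcs T \<and> B \<subseteq> fixator {z, w} \<and>
        \<alpha> \<in> epi (L\<lparr>carrier := B\<rparr>) M \<and>
        (\<forall>b\<in>B. loc z b = \<one>\<^bsub>BijGroup (edges_from T z)\<^esub> \<longrightarrow> \<alpha> b = \<one>\<^bsub>M\<^esub>)"
      using less.hyps[OF less_card Ks] by auto
    then show ?thesis using KA by (intro exI[of _ B] exI[of _ z] exI[of _ w]) auto
  next
    case 2
    have "\<forall>b\<in>A. loc z b = \<one>\<^bsub>BijGroup (edges_from T z)\<^esub> \<longrightarrow> \<alpha> b = \<one>\<^bsub>M\<^esub>"
      using 2 K_iff unfolding E_def by (metis imageI singletonD)
    then show ?thesis using A zw(1) Az(2) \<alpha> by (intro exI[of _ A] exI[of _ z] exI[of _ w]) simp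
  qed
qed

end

section \<open>Actions with dense image\<close>

text \<open>
  Density of the image in \<open>G\<close> for the topology of pointwise convergence, spelled out on finite sets of vertices.
  In particular the local permutation groups of the image are those of \<open>G\<close>.
\<close>

locale dense_tree_action = tree_action L T \<phi>
  for L (structure) and T :: "'a pair_pre_digraph" and \<phi> +
  fixes G
  assumes subgroup_G: "subgroup G (aut_group T)"
    and image_G: "\<phi> ` carrier L \<subseteq> G"
    and dense: "g \<in> G \<Longrightarrow> finite P \<Longrightarrow> P \<subseteq> pverts T \<Longrightarrow> \<exists>l\<in>carrier L. \<forall>p\<in>P. \<phi> l p = g p"
begin

lemma local_lift:
  assumes "g \<in> G" "g x = x" "x \<in> V"
  obtains l where "l \<in> stab x" "\<And>w. (x, w) \<in> parcs T \<Longrightarrow> \<phi> l w = g w"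
proof -
  have "vertex_ball T 1 x \<subseteq> V" by (rule vertex_ball_verts[OF tree assms(3)])
  from dense[OF assms(1) finite_vertex_ball[OF tree] this]
  obtain l where "l \<in> carrier L" "\<forall>p\<in>vertex_ball T 1 x. \<phi> l p = g p" by auto
  then show thesis using that[of l] assms(2) unfolding vertex_ball_1 stab_def by simp
qed

lemma local_perms_loc:
  assumes x: "x \<in> V" shows "local_perms T G x = loc x ` stab x"
proof
  show "loc x ` stab x \<subseteq> local_perms T G x"
    using image_G by (auto simp: local_perms_def loc_def stab_def)
  show "local_perms T G x \<subseteq> loc x ` stab x"
  proof
    fix f assume "f \<in> local_perms T G x"
    then obtain g where g: "g \<in> G" "g x = x" "f = restrict (map_prod g g) (edges_from T x)"
      unfolding local_perms_def by auto
    obtain l where l: "l \<in> stab x" "\<And>w. (x, w) \<in> parcs T \<Longrightarrow> \<phi> l w = g w"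
      using local_lift[OF g(1,2) x] by metis
    have "loc x l = f" unfolding loc_def g(3)
      by (rule restrict_ext) (use l g(2) stabD(2)[OF l(1)] in \<open>auto simp: in_edges_from\<close>)
    then show "f \<in> loc x ` stab x" using l(1) by auto
  qed
qed

lemma subgroup_local_perms:
  assumes x: "x \<in> V" shows "subgroup (local_perms T G x) (BijGroup (edges_from T x))"
  using group_hom.img_is_subgroup[OF loc_group_hom[OF x]] local_perms_loc[OF x] by simp

lemma loc_onto_local_group:
  assumes x: "x \<in> V" shows "group_hom (L\<lparr>carrier := stab x\<rparr>) (local_group T G x) (loc x)"
proof -
  have "loc x \<in> hom (L\<lparr>carrier := stab x\<rparr>) (local_group T G x)"
    using loc_hom[OF x] by (auto simp: hom_def local_perms_loc[OF x])
  then show ?thesis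
    using subgroup_imp_group[OF subgroup_stab[OF x]] group_perm_group[OF subgroup_local_perms[OF x]]
    by (simp add: group_hom_def group_hom_axioms_def)
qed

lemma loc_normal:
  assumes x: "x \<in> V" and A: "A \<lhd> L\<lparr>carrier := stab x\<rparr>"
  shows "loc x ` A \<lhd> local_group T G x"
  by (rule normal.surj_hom_normal_subgroup[OF A loc_onto_local_group[OF x]])
    (simp add: local_perms_loc[OF x])

text \<open>
  Quasi-primitivity, lifted from the local permutation group to \<open>L\<close>.
\<close>

lemma normal_transitive_on_star:
  assumes x: "x \<in> V" and qp: "quasi_primitive (edges_from T x) (local_perms T G x)"
    and A: "A \<lhd> L\<lparr>carrier := stab x\<rparr>"
    and moves: "a \<in> A" "(x, w) \<in> parcs T" "\<phi> a w \<noteq> w"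
    and u: "(x, u) \<in> parcs T" "(x, v) \<in> parcs T"
  shows "\<exists>b\<in>A. \<phi> b u = v"
proof -
  have As: "A \<subseteq> stab x" using subgroup.subset[OF normal_imp_subgroup[OF A]] by simp
  have "loc x a \<noteq> \<one>\<^bsub>local_group T G x\<^esub>"
    using loc_trivial_iff[OF x subsetD[OF As moves(1)]] moves(2,3) by auto
  then have nt: "loc x ` A \<noteq> {\<one>\<^bsub>local_group T G x\<^esub>}" using moves(1) by auto
  have "(x, u) \<in> edges_from T x" "(x, v) \<in> edges_from T x" using u by (simp_all add: in_edges_from)
  then obtain n where n: "n \<in> loc x ` A" "n (x, u) = (x, v)"
    by (rule quasi_primitive_transitive[OF qp loc_normal[OF x A] nt])
  then obtain b where b: "b \<in> A" "n = loc x b" by auto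
  then have "(x, \<phi> b u) = (x, v)" using loc_apply[OF u(1) subsetD[OF As b(1)]] n(2) by simp
  then show ?thesis using b(1) by auto
qed

lemma stab_transitive_on_star:
  assumes x: "x \<in> V" and qp: "quasi_primitive (edges_from T x) (local_perms T G x)"
    and nt: "local_perms T G x \<noteq> {\<one>\<^bsub>local_group T G x\<^esub>}"
    and u: "(x, u) \<in> parcs T" "(x, v) \<in> parcs T"
  shows "\<exists>b\<in>stab x. \<phi> b u = v"
proof -
  have "\<one>\<^bsub>local_group T G x\<^esub> \<in> local_perms T G x"
    using subgroup.one_closed[OF subgroup_local_perms[OF x]] by simp
  then obtain f where f: "f \<in> local_perms T G x" "f \<noteq> \<one>\<^bsub>local_group T G x\<^esub>" using nt by auto
  then obtain a where a: "a \<in> stab x" "loc x a \<noteq> \<one>\<^bsub>BijGroup (edges_from T x)\<^esub>"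
    using local_perms_loc[OF x] by auto
  then obtain w where w: "(x, w) \<in> parcs T" "\<phi> a w \<noteq> w" using loc_trivial_iff[OF x a(1)] by auto
  have "stab x \<lhd> L\<lparr>carrier := stab x\<rparr>"
    by (rule normal_in_subgroup)
      (auto intro!: subgroup_stab[OF x] subgroup.m_closed[OF subgroup_stab[OF x]] subgroup.m_inv_closed[OF subgroup_stab[OF x]])
  from normal_transitive_on_star[OF x qp this a(1) w u] show ?thesis .
qed

end

section \<open>Discrete actions on two trees\<close>

text \<open>
  The last assumption is discreteness in the product of the two automorphism groups, read at the neutral element;
  either of the two actions alone may have a kernel and a dense image.
\<close>

locale two_tree_actions =
  X: dense_tree_action L T1 \<phi>1 G1 + Y: dense_tree_action L T2 \<phi>2 G2
  for L :: "('g, 'r) monoid_scheme" (structure)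
    and T1 :: "'a pair_pre_digraph" and \<phi>1 G1 and T2 :: "'b pair_pre_digraph" and \<phi>2 G2 +
  assumes discrete: "\<exists>P Q. finite P \<and> P \<subseteq> pverts T1 \<and> finite Q \<and> Q \<subseteq> pverts T2 \<and>
    (\<forall>g\<in>carrier L. (\<forall>p\<in>P. \<phi>1 g p = p) \<longrightarrow> (\<forall>q\<in>Q. \<phi>2 g q = q) \<longrightarrow> g = \<one>)"
begin

lemma swap: "two_tree_actions L T2 \<phi>2 G2 T1 \<phi>1 G1"
proof -
  have "\<exists>P Q. finite P \<and> P \<subseteq> pverts T2 \<and> finite Q \<and> Q \<subseteq> pverts T1 \<and>
    (\<forall>g\<in>carrier L. (\<forall>p\<in>P. \<phi>2 g p = p) \<longrightarrow> (\<forall>q\<in>Q. \<phi>1 g q = q) \<longrightarrow> g = \<one>)"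
    using discrete by metis
  then show ?thesis
    using X.dense_tree_action_axioms Y.dense_tree_action_axioms
    by (simp add: two_tree_actions_def two_tree_actions_axioms_def)
qed

text \<open>
  By discreteness an element is determined by its values on finitely many vertices, and an element that fixes
  \<open>x\<close> and \<open>y\<close> can move each of these only inside a ball.
\<close>

lemma finite_stabilizers:
  assumes x: "x \<in> X.V" and y: "y \<in> Y.V" shows "finite (X.stab x \<inter> Y.stab y)"
proof -
  obtain P Q where PQ: "finite P" "P \<subseteq> pverts T1" "finite Q" "Q \<subseteq> pverts T2"
    and triv: "\<And>g. g \<in> carrier L \<Longrightarrow> \<forall>p\<in>P. \<phi>1 g p = p \<Longrightarrow> \<forall>q\<in>Q. \<phi>2 g q = q \<Longrightarrow> g = \<one>"
    using discrete by metis
  have "\<exists>n. p \<in> vertex_ball T1 n x" if "p \<in> P" for p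
    using vertex_ball_exhausts[OF X.tree x, of p] that PQ(2) by auto
  then obtain m where m: "\<And>p. p \<in> P \<Longrightarrow> p \<in> vertex_ball T1 (m p) x" by metis
  have "\<exists>n. q \<in> vertex_ball T2 n y" if "q \<in> Q" for q
    using vertex_ball_exhausts[OF Y.tree y, of q] that PQ(4) by auto
  then obtain n where n: "\<And>q. q \<in> Q \<Longrightarrow> q \<in> vertex_ball T2 (n q) y" by metis
  let ?S = "X.stab x \<inter> Y.stab y"
  let ?f = "\<lambda>g. (restrict (\<phi>1 g) P, restrict (\<phi>2 g) Q)"
  have "?f ` ?S \<subseteq> (\<Pi>\<^sub>E p\<in>P. vertex_ball T1 (m p) x) \<times> (\<Pi>\<^sub>E q\<in>Q. vertex_ball T2 (n q) y)"
  proof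
    fix fg assume "fg \<in> ?f ` ?S"
    then obtain g where g: "g \<in> X.stab x" "g \<in> Y.stab y" and fg: "fg = ?f g" by auto
    have "\<phi>1 g p \<in> vertex_ball T1 (m p) x" if "p \<in> P" for p
      using X.act_ball[OF X.stabD(1)[OF g(1)] x m[OF that]] X.stabD(2)[OF g(1)] by simp
    moreover have "\<phi>2 g q \<in> vertex_ball T2 (n q) y" if "q \<in> Q" for q
      using Y.act_ball[OF Y.stabD(1)[OF g(2)] y n[OF that]] Y.stabD(2)[OF g(2)] by simp
    ultimately show "fg \<in> (\<Pi>\<^sub>E p\<in>P. vertex_ball T1 (m p) x) \<times> (\<Pi>\<^sub>E q\<in>Q. vertex_ball T2 (n q) y)"
      unfolding fg by (simp add: restrict_PiE_iff)
  qed
  moreover have "finite ((\<Pi>\<^sub>E p\<in>P. vertex_ball T1 (m p) x) \<times> (\<Pi>\<^sub>E q\<in>Q. vertex_ball T2 (n q) y))"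
    by (intro finite_cartesian_product finite_PiE PQ finite_vertex_ball[OF X.tree] finite_vertex_ball[OF Y.tree])
  ultimately have "finite (?f ` ?S)" by (rule finite_subset)
  moreover have "inj_on ?f ?S"
  proof (rule inj_onI)
    fix g h assume "g \<in> ?S" "h \<in> ?S" and eq: "?f g = ?f h"
    then have c: "g \<in> carrier L" "h \<in> carrier L" using X.stabD(1) by auto
    have e: "\<phi>1 g p = \<phi>1 h p" if "p \<in> P" for p using eq that by (metis prod.inject restrict_apply')
    have e': "\<phi>2 g q = \<phi>2 h q" if "q \<in> Q" for q using eq that by (metis prod.inject restrict_apply')
    have "inv h \<otimes> g = \<one>"
    proof (rule triv)
      show "\<forall>p\<in>P. \<phi>1 (inv h \<otimes> g) p = p"
        using c PQ(2) by (auto simp: X.act_mult e X.act_inv subset_iff)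
      show "\<forall>q\<in>Q. \<phi>2 (inv h \<otimes> g) q = q"
        using c PQ(4) by (auto simp: Y.act_mult e' Y.act_inv subset_iff)
    qed (use c in simp)
    then show "g = h" using c by (metis X.inv_closed X.inv_equality X.inv_inv)
  qed
  ultimately show ?thesis by (rule finite_imageD)
qed

end

lemma (in tree_action) fixator_conj:
  assumes "P \<subseteq> V" "g \<in> carrier L" "k \<in> carrier L" and fix_k: "\<And>p. p \<in> P \<Longrightarrow> \<phi> k (\<phi> (inv g) p) = \<phi> (inv g) p"
  shows "g \<otimes> k \<otimes> inv g \<in> fixator P"
  using assms(1-3) fix_k by (auto simp: fixator_def act_mult act_closed act_inv subset_iff)

lemma (in tree_action) conj_fixes:
  assumes "g \<in> carrier L" "k \<in> carrier L" "v \<in> V" "\<phi> k v = v"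
  shows "\<phi> (g \<otimes> k \<otimes> inv g) (\<phi> g v) = \<phi> g v"
  using assms by (simp add: act_mult act_closed act_inv)

context two_tree_actions
begin

lemma faithful:
  assumes "g \<in> carrier L" "\<forall>v\<in>X.V. \<phi>1 g v = v" "\<forall>v\<in>Y.V. \<phi>2 g v = v" shows "g = \<one>"
  using discrete assms by (metis subset_iff)

text \<open>
  Suppose the kernel \<open>K\<close> of the action on the second tree contains a nontrivial element that fixes a vertex of the
  first one. It then fixes a vertex \<open>x\<close> and moves a neighbour \<open>w\<close> of \<open>x\<close>, and quasi-primitivity makes the
  stabilizer of \<open>x\<close> in \<open>K\<close> transitive on the star of \<open>x\<close>. The same holds at all neighbours of \<open>w\<close>, as they are
  conjugate to \<open>x\<close>. The stabilizers in \<open>K\<close> of the neighbours of \<open>w\<close> therefore generate a group that moves the star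
  of \<open>w\<close> over the whole tree. Being finite, they are centralized by every element of \<open>L\<close> that fixes a suitable
  finite set of vertices; such an element fixes everything, which by density contradicts the non-discreteness of \<open>G1\<close>.
\<close>

lemma trivial_on_other_tree_imp_free:
  assumes nd: "\<And>P. finite P \<Longrightarrow> P \<subseteq> X.V \<Longrightarrow> \<exists>g\<in>G1. (\<forall>p\<in>P. g p = p) \<and> (\<exists>q\<in>X.V. g q \<noteq> q)"
    and qp: "locally_quasi_primitive T1 G1"
    and nt: "\<And>x. x \<in> X.V \<Longrightarrow> local_perms T1 G1 x \<noteq> {\<one>\<^bsub>local_group T1 G1 x\<^esub>}"
    and k: "k \<in> carrier L" "\<forall>v\<in>Y.V. \<phi>2 k v = v" and u: "u \<in> X.V" "\<phi>1 k u = u"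
    and Y_ne: "y \<in> Y.V"
  shows "k = \<one>"
proof (rule ccontr)
  assume "k \<noteq> \<one>"
  then obtain v where "v \<in> X.V" "\<phi>1 k v \<noteq> v" using faithful[OF k(1)] k(2) by metis
  then obtain x w where x: "x \<in> X.V" "\<phi>1 k x = x" and xw: "(x, w) \<in> parcs T1" "\<phi>1 k w \<noteq> w"
    by (rule X.moved_neighbour[OF u])
  have wV: "w \<in> X.V" using arcs_verts[OF X.tree xw(1)] by simp
  have qpx: "quasi_primitive (edges_from T1 z) (local_perms T1 G1 z)" if "z \<in> X.V" for z
    using qp that by (simp add: locally_quasi_primitive_def)
  define K where "K = Y.fixator Y.V"
  have K: "subgroup K L" unfolding K_def by (rule Y.subgroup_fixator) simp
  have Kconj: "g \<otimes> a \<otimes> inv g \<in> K" if "g \<in> carrier L" "a \<in> K" for g a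
  proof -
    have a: "a \<in> carrier L" "\<And>v. v \<in> Y.V \<Longrightarrow> \<phi>2 a v = v" using that(2) by (auto simp: K_def Y.fixator_def)
    show ?thesis unfolding K_def
      by (rule Y.fixator_conj[OF order_refl that(1) a(1)]) (simp add: a(2) Y.act_closed that(1))
  qed
  define KS where "KS z = K \<inter> X.stab z" for z
  have KSn: "KS z \<lhd> L\<lparr>carrier := X.stab z\<rparr>" if z: "z \<in> X.V" for z
  proof (rule X.normal_in_subgroup[OF X.subgroup_stab[OF z]])
    show "subgroup (KS z) L" unfolding KS_def by (rule X.subgroups_Inter_pair[OF K X.subgroup_stab[OF z]])
    show "KS z \<subseteq> X.stab z" by (simp add: KS_def)
    fix h a assume h: "h \<in> X.stab z" and a: "a \<in> KS z"
    have aK: "a \<in> K" "a \<in> X.stab z" using a by (simp_all add: KS_def)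
    have "h \<otimes> a \<otimes> inv h \<in> K" by (rule Kconj[OF X.stabD(1)[OF h] aK(1)])
    moreover have "h \<otimes> a \<otimes> inv h \<in> X.stab z"
      by (intro subgroup.m_closed[OF X.subgroup_stab[OF z]] subgroup.m_inv_closed[OF X.subgroup_stab[OF z]] h aK(2))
    ultimately show "h \<otimes> a \<otimes> inv h \<in> KS z" by (simp add: KS_def)
  qed
  have kKS: "k \<in> KS x" using k x by (simp add: KS_def K_def Y.fixator_def X.stab_def)
  \<comment> \<open>Every neighbour \<open>z\<close> of \<open>w\<close> is a translate of \<open>x\<close> under the stabilizer of \<open>w\<close>, so \<open>K\<close> acts around \<open>z\<close> as it
    does around \<open>x\<close>.\<close>
  have trans: "\<exists>b\<in>KS z. \<phi>1 b w = v" if zw: "(w, z) \<in> parcs T1" and zv: "(z, v) \<in> parcs T1" for z v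
  proof -
    have zV: "z \<in> X.V" using arcs_verts[OF X.tree zw] by simp
    have "(w, x) \<in> parcs T1" by (rule arcs_sym[OF X.tree xw(1)])
    from X.stab_transitive_on_star[OF wV qpx[OF wV] nt[OF wV] this zw]
    obtain g where g: "g \<in> X.stab w" "\<phi>1 g x = z" by auto
    note gL = X.stabD(1)[OF g(1)] and gw = X.stabD(2)[OF g(1)]
    let ?a = "g \<otimes> k \<otimes> inv g"
    have "?a \<in> K" by (rule Kconj[OF gL]) (use kKS in \<open>simp add: KS_def\<close>)
    moreover have "\<phi>1 ?a z = z" using X.conj_fixes[OF gL k(1) x] g(2) by simp
    ultimately have a: "?a \<in> KS z" using gL k(1) by (simp add: KS_def X.stab_def)
    have iw: "\<phi>1 (inv g) w = w" using X.act_inv(1)[OF gL wV] gw by simp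
    have "\<phi>1 ?a w = \<phi>1 g (\<phi>1 k w)" using gL k(1) wV iw by (simp add: X.act_mult X.act_closed)
    moreover have "\<phi>1 g (\<phi>1 k w) \<noteq> w"
      using X.act_inv(1)[OF gL X.act_closed[OF k(1) wV]] iw xw(2) by metis
    ultimately have "\<phi>1 ?a w \<noteq> w" by simp
    from X.normal_transitive_on_star[OF zV qpx[OF zV] KSn[OF zV] a arcs_sym[OF X.tree zw] this arcs_sym[OF X.tree zw] zv]
    show ?thesis .
  qed
  obtain P Q where PQ: "finite P" "P \<subseteq> X.V" "finite Q" "Q \<subseteq> Y.V"
    and triv: "\<And>g. g \<in> carrier L \<Longrightarrow> \<forall>p\<in>P. \<phi>1 g p = p \<Longrightarrow> \<forall>q\<in>Q. \<phi>2 g q = q \<Longrightarrow> g = \<one>"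
    using discrete by metis
  define KK where "KK = (\<Union>z\<in>{z. (w, z) \<in> parcs T1}. KS z)"
  have "finite (KS z)" if "(w, z) \<in> parcs T1" for z
  proof (rule finite_subset)
    show "finite (X.stab z \<inter> Y.stab y)" using arcs_verts[OF X.tree that] Y_ne by (intro finite_stabilizers) auto
    show "KS z \<subseteq> X.stab z \<inter> Y.stab y" using Y_ne by (auto simp: KS_def K_def Y.fixator_def Y.stab_def)
  qed
  then have finKK: "finite KK" unfolding KK_def using finite_neighbours[OF X.tree] by simp
  have KKK: "KK \<subseteq> K" by (auto simp: KK_def KS_def)
  have KL: "K \<subseteq> carrier L" by (rule subgroup.subset[OF K])
  define D where "D = vertex_ball T1 1 w"
  have DV: "D \<subseteq> X.V" unfolding D_def by (rule vertex_ball_verts[OF X.tree wV])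
  define R where "R = D \<union> P \<union> (\<Union>a\<in>KK. \<phi>1 a ` P)"
  have finR: "finite R" unfolding R_def D_def using finKK PQ(1) finite_vertex_ball[OF X.tree] by simp
  have RV: "R \<subseteq> X.V" unfolding R_def using DV PQ(2) KKK KL X.act_closed by (auto simp: subset_iff)
  \<comment> \<open>A conjugate of \<open>a \<in> KK\<close> by an element \<open>h\<close> fixing \<open>R\<close> lies in \<open>K\<close> and agrees with \<open>a\<close> on \<open>P\<close>, so it
    equals \<open>a\<close>. Hence \<open>h\<close> fixes the translates of \<open>D\<close> under the centralizer of \<open>h\<close>; as this centralizer contains
    \<open>KK\<close>, the translates cover the tree.\<close>
  have fixes_all: "\<phi>1 h v = v" if h: "h \<in> carrier L" "\<forall>r\<in>R. \<phi>1 h r = r" and v: "v \<in> X.V" for h v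
  proof -
    have comm: "h \<otimes> a = a \<otimes> h" if a: "a \<in> KK" for a
    proof -
      have aK: "a \<in> K" "a \<in> carrier L" using a KKK KL by auto
      have ha: "h \<otimes> a \<otimes> inv h \<in> K" by (rule Kconj[OF h(1) aK(1)])
      have hL: "h \<otimes> a \<otimes> inv h \<in> carrier L" using h(1) aK(2) by simp
      have "inv a \<otimes> (h \<otimes> a \<otimes> inv h) = \<one>"
      proof (rule triv)
        show "inv a \<otimes> (h \<otimes> a \<otimes> inv h) \<in> carrier L" using aK(2) hL by simp
        have "inv a \<otimes> (h \<otimes> a \<otimes> inv h) \<in> K"
          by (intro subgroup.m_closed[OF K] subgroup.m_inv_closed[OF K] ha aK(1))
        then show "\<forall>q\<in>Q. \<phi>2 (inv a \<otimes> (h \<otimes> a \<otimes> inv h)) q = q"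
          using PQ(4) by (auto simp: K_def Y.fixator_def)
        show "\<forall>p\<in>P. \<phi>1 (inv a \<otimes> (h \<otimes> a \<otimes> inv h)) p = p"
        proof
          fix p assume p: "p \<in> P"
          have pV: "p \<in> X.V" using p PQ(2) by auto
          have "\<phi>1 h p = p" using h(2) p by (auto simp: R_def)
          then have ip: "\<phi>1 (inv h) p = p" using X.act_inv(1)[OF h(1) pV] by simp
          have "\<phi>1 h (\<phi>1 a p) = \<phi>1 a p" using h(2) p a unfolding R_def by blast
          then show "\<phi>1 (inv a \<otimes> (h \<otimes> a \<otimes> inv h)) p = p"
            using h(1) aK(2) pV ip by (simp add: X.act_mult X.act_closed X.act_inv)
        qed
      qed
      then have "h \<otimes> a \<otimes> inv h = a" using aK(2) hL by (metis X.inv_closed X.inv_equality X.inv_inv)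
      then show ?thesis using aK(2) h(1) by (metis X.inv_solve_right' X.m_closed)
    qed
    define C where "C = {c \<in> carrier L. h \<otimes> c = c \<otimes> h}"
    let ?Z = "{v. \<exists>c\<in>C. \<exists>d\<in>D. v = \<phi>1 c d}"
    have "X.V \<subseteq> ?Z"
    proof (rule closed_under_neighbours[OF X.tree _ wV])
      have "\<one> \<in> C" "w \<in> D" using h(1) by (simp_all add: C_def D_def centre_in_vertex_ball)
      then show "w \<in> ?Z" using X.act_one[OF wV] by force
    next
      fix v v' assume "v \<in> ?Z" and vv': "(v, v') \<in> parcs T1"
      then obtain c d where c: "c \<in> C" and d: "d \<in> D" and v: "v = \<phi>1 c d" by auto
      have cL: "c \<in> carrier L" "h \<otimes> c = c \<otimes> h" using c by (auto simp: C_def)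
      have v'V: "v' \<in> X.V" using arcs_verts[OF X.tree vv'] by simp
      define e where "e = \<phi>1 (inv c) v'"
      have v'e: "v' = \<phi>1 c e" using X.act_inv(2)[OF cL(1) v'V] by (simp add: e_def)
      have dV: "d \<in> X.V" using d DV by auto
      have de: "(d, e) \<in> parcs T1"
        using X.act_arc[OF X.inv_closed[OF cL(1)] vv'] X.act_inv(1)[OF cL(1) dV] by (simp add: v e_def)
      show "v' \<in> ?Z"
      proof (cases "d = w")
        case True
        then have "e \<in> D" using de unfolding D_def vertex_ball_1 by simp
        then show ?thesis using c v'e by auto
      next
        case False
        then have wd: "(w, d) \<in> parcs T1" using d unfolding D_def vertex_ball_1 by simp
        then obtain b where b: "b \<in> KS d" "\<phi>1 b w = e" using trans[OF wd de] by auto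
        have bKK: "b \<in> KK" using b(1) wd by (auto simp: KK_def)
        have bL: "b \<in> carrier L" using bKK KKK KL by auto
        have "h \<otimes> (c \<otimes> b) = c \<otimes> h \<otimes> b" using cL bL h(1) by (simp add: X.m_assoc[symmetric])
        also have "\<dots> = c \<otimes> (b \<otimes> h)" using cL(1) bL h(1) comm[OF bKK] by (simp add: X.m_assoc)
        finally have "c \<otimes> b \<in> C" using cL(1) bL h(1) by (simp add: C_def X.m_assoc)
        moreover have "v' = \<phi>1 (c \<otimes> b) w" using X.act_mult[OF cL(1) bL wV] b(2) v'e by simp
        moreover have "w \<in> D" by (simp add: D_def centre_in_vertex_ball)
        ultimately show ?thesis by auto
      qed
    qed
    then obtain c d where c: "c \<in> carrier L" "h \<otimes> c = c \<otimes> h" and d: "d \<in> D" "v = \<phi>1 c d"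
      using v by (auto simp: C_def)
    have dV: "d \<in> X.V" using d(1) DV by auto
    have "\<phi>1 h v = \<phi>1 (c \<otimes> h) d" using X.act_mult[OF h(1) c(1) dV] c(2) d(2) by simp
    also have "\<dots> = v" using X.act_mult[OF c(1) h(1) dV] h(2) d by (simp add: R_def)
    finally show ?thesis .
  qed
  obtain g q where g: "g \<in> G1" "\<forall>p\<in>R. g p = p" "q \<in> X.V" "g q \<noteq> q" using nd[OF finR RV] by auto
  obtain l where l: "l \<in> carrier L" "\<forall>p\<in>insert q R. \<phi>1 l p = g p"
    using X.dense[OF g(1), of "insert q R"] finR RV g(3) by auto
  then have "\<phi>1 l q = q" using fixes_all[OF l(1) _ g(3)] g(2) by simp
  then show False using l(2) g(4) by simp
qed

text \<open>
  The element \<open>q\<close> fixes a large ball around \<open>y\<close>, fixes some vertex \<open>x\<close> and moves a neighbour of \<open>x\<close>. Its conjugates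
  by elements that stabilize \<open>x\<close>, realize a given local permutation at \<open>x\<close> and move \<open>y\<close> by at most \<open>R\<close> still fix the
  star of \<open>y\<close>. Their images at \<open>x\<close> are all the conjugates of the image of \<open>q\<close> in the local permutation group, so
  they generate a normal subgroup of it.
\<close>

lemma normal_subgroup_from_short_element:
  assumes y: "y \<in> Y.V"
    and R: "\<And>x g. x \<in> X.V \<Longrightarrow> g \<in> G1 \<Longrightarrow> g x = x \<Longrightarrow>
        \<exists>l\<in>carrier L. \<phi>1 l x = x \<and> (\<forall>w. (x, w) \<in> parcs T1 \<longrightarrow> \<phi>1 l w = g w) \<and> \<phi>2 l y \<in> vertex_ball T2 R y"
    and q: "q \<in> Y.fixator (vertex_ball T2 (R + 1) y)" "u \<in> X.V" "\<phi>1 q u = u"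
    and moves: "v \<in> X.V" "\<phi>1 q v \<noteq> v"
  obtains x N where "x \<in> X.V" "N \<lhd> local_group T1 G1 x" "N \<noteq> {\<one>\<^bsub>local_group T1 G1 x\<^esub>}"
    "N \<subseteq> X.loc x ` (X.stab x \<inter> Y.fixator (vertex_ball T2 1 y))"
proof -
  obtain x w where x: "x \<in> X.V" "\<phi>1 q x = x" and xw: "(x, w) \<in> parcs T1" "\<phi>1 q w \<noteq> w"
    by (rule X.moved_neighbour[OF q(2,3) moves])
  let ?F = "local_group T1 G1 x"
  let ?B = "vertex_ball T2 1 y"
  let ?A = "X.stab x \<inter> Y.fixator ?B"
  interpret H: group_hom "L\<lparr>carrier := X.stab x\<rparr>" ?F "X.loc x" by (rule X.loc_onto_local_group[OF x(1)])
  have BV: "?B \<subseteq> Y.V" by (rule vertex_ball_verts[OF Y.tree y])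
  have subA: "subgroup ?A L"
    by (rule X.subgroups_Inter_pair[OF X.subgroup_stab[OF x(1)] Y.subgroup_fixator[OF BV]])
  have "subgroup ?A (L\<lparr>carrier := X.stab x\<rparr>)"
    by (rule X.subgroup_incl[OF subA X.subgroup_stab[OF x(1)]]) simp
  then have subimg: "subgroup (X.loc x ` ?A) ?F" by (rule H.subgroup_img_is_subgroup)
  have qL: "q \<in> carrier L" using q(1) by (simp add: Y.fixator_def)
  have qx: "q \<in> X.stab x" using qL x(2) by (simp add: X.stab_def)
  define C where "C = {f \<otimes>\<^bsub>?F\<^esub> X.loc x q \<otimes>\<^bsub>?F\<^esub> inv\<^bsub>?F\<^esub> f | f. f \<in> carrier ?F}"
  have qF: "X.loc x q \<in> carrier ?F" using H.hom_closed[of q] qx by simp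
  have CF: "C \<subseteq> carrier ?F"
  proof
    fix c assume "c \<in> C"
    then obtain f where f: "f \<in> carrier ?F" and c: "c = f \<otimes>\<^bsub>?F\<^esub> X.loc x q \<otimes>\<^bsub>?F\<^esub> inv\<^bsub>?F\<^esub> f" unfolding C_def by auto
    show "c \<in> carrier ?F" unfolding c by (intro H.H.m_closed H.H.inv_closed f qF)
  qed
  have CA: "C \<subseteq> X.loc x ` ?A"
  proof
    fix c assume "c \<in> C"
    then obtain f where f: "f \<in> local_perms T1 G1 x" and c: "c = f \<otimes>\<^bsub>?F\<^esub> X.loc x q \<otimes>\<^bsub>?F\<^esub> inv\<^bsub>?F\<^esub> f"
      by (auto simp: C_def)
    then obtain g where g: "g \<in> X.stab x" "f = X.loc x g" using X.local_perms_loc[OF x(1)] by auto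
    have "\<phi>1 g \<in> G1" using X.image_G X.stabD(1)[OF g(1)] by auto
    from R[OF x(1) this X.stabD(2)[OF g(1)]]
    obtain l where l: "l \<in> X.stab x" "\<forall>w. (x, w) \<in> parcs T1 \<longrightarrow> \<phi>1 l w = \<phi>1 g w" "\<phi>2 l y \<in> vertex_ball T2 R y"
      by (auto simp: X.stab_def)
    have lL: "l \<in> carrier L" by (rule X.stabD(1)[OF l(1)])
    have lf: "X.loc x l = f" using X.loc_eq_iff[OF l(1) g(1)] l(2) g(2) by simp
    have "y \<in> vertex_ball T2 R (\<phi>2 l y)" by (rule vertex_ball_sym[OF Y.tree l(3)])
    from Y.act_ball[OF X.inv_closed[OF lL] Y.act_closed[OF lL y] this]
    have "\<phi>2 (inv l) y \<in> vertex_ball T2 R y" using Y.act_inv(1)[OF lL y] by simp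
    then have near: "\<phi>2 (inv l) p \<in> vertex_ball T2 (R + 1) y" if "p \<in> ?B" for p
      using vertex_ball_trans Y.act_ball[OF X.inv_closed[OF lL] y that] by metis
    have "l \<otimes> q \<otimes> inv l \<in> Y.fixator ?B"
      by (rule Y.fixator_conj[OF BV lL qL]) (use near q(1) in \<open>simp add: Y.fixator_def\<close>)
    moreover have "l \<otimes> q \<otimes> inv l \<in> X.stab x"
      by (intro subgroup.m_closed[OF X.subgroup_stab[OF x(1)]] subgroup.m_inv_closed[OF X.subgroup_stab[OF x(1)]] l(1) qx)
    moreover have "X.loc x (l \<otimes> q \<otimes> inv l) = c"
    proof -
      have il: "inv l \<in> X.stab x" by (rule subgroup.m_inv_closed[OF X.subgroup_stab[OF x(1)] l(1)])
      have lq: "l \<otimes> q \<in> X.stab x" by (rule subgroup.m_closed[OF X.subgroup_stab[OF x(1)] l(1) qx])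
      have "X.loc x (l \<otimes> q \<otimes> inv l) = X.loc x l \<otimes>\<^bsub>?F\<^esub> X.loc x q \<otimes>\<^bsub>?F\<^esub> X.loc x (inv l)"
        using H.hom_mult[of "l \<otimes> q" "inv l"] H.hom_mult[of l q] lq il l(1) qx by simp
      moreover have "X.loc x (inv l) = inv\<^bsub>?F\<^esub> X.loc x l"
        using H.hom_inv[of l] l(1) X.m_inv_consistent[OF X.subgroup_stab[OF x(1)] l(1)] by simp
      ultimately show ?thesis using lf c by simp
    qed
    ultimately show "c \<in> X.loc x ` ?A" by auto
  qed
  define N where "N = generate ?F C"
  have "N \<lhd> ?F" unfolding N_def
  proof (rule H.H.normal_generateI[OF CF])
    fix c g assume "c \<in> C" and g: "g \<in> carrier ?F"
    then obtain f where f: "f \<in> carrier ?F" and c: "c = f \<otimes>\<^bsub>?F\<^esub> X.loc x q \<otimes>\<^bsub>?F\<^esub> inv\<^bsub>?F\<^esub> f" unfolding C_def by auto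
    have "g \<otimes>\<^bsub>?F\<^esub> c \<otimes>\<^bsub>?F\<^esub> inv\<^bsub>?F\<^esub> g = (g \<otimes>\<^bsub>?F\<^esub> f) \<otimes>\<^bsub>?F\<^esub> X.loc x q \<otimes>\<^bsub>?F\<^esub> inv\<^bsub>?F\<^esub> (g \<otimes>\<^bsub>?F\<^esub> f)"
      unfolding c H.H.inv_mult_group[OF g f] using f g qF by (simp only: H.H.m_assoc H.H.inv_closed H.H.m_closed)
    then show "g \<otimes>\<^bsub>?F\<^esub> c \<otimes>\<^bsub>?F\<^esub> inv\<^bsub>?F\<^esub> g \<in> C" unfolding C_def using H.H.m_closed[OF g f] by (intro CollectI exI[of _ "g \<otimes>\<^bsub>?F\<^esub> f"]) simp
  qed
  moreover have "N \<subseteq> X.loc x ` ?A" unfolding N_def by (rule H.H.generate_subgroup_incl[OF CA subimg])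
  moreover have "N \<noteq> {\<one>\<^bsub>?F\<^esub>}"
  proof -
    have "\<one>\<^bsub>?F\<^esub> \<otimes>\<^bsub>?F\<^esub> X.loc x q \<otimes>\<^bsub>?F\<^esub> inv\<^bsub>?F\<^esub> \<one>\<^bsub>?F\<^esub> = X.loc x q"
      using qF by (simp only: H.H.l_one H.H.inv_one H.H.r_one)
    then have "X.loc x q \<in> C" unfolding C_def using H.H.one_closed by (metis (mono_tags, lifting) mem_Collect_eq)
    then have "X.loc x q \<in> N" unfolding N_def by (rule generate.incl)
    moreover have "X.loc x q \<noteq> \<one>\<^bsub>?F\<^esub>" using X.loc_trivial_iff[OF x(1) qx] xw by auto
    ultimately show ?thesis by auto
  qed
  ultimately show thesis using that x(1) by simp
qed

end

section \<open>Lifting local permutations with bounded displacement\<close>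

lemma finite_uniform_bound:
  assumes "finite S" and "\<And>s. s \<in> S \<Longrightarrow> \<exists>n::nat. P s n" and "\<And>s m n. P s m \<Longrightarrow> m \<le> n \<Longrightarrow> P s n"
  shows "\<exists>n. \<forall>s\<in>S. P s n"
  using assms(1,2)
proof (induction S rule: finite_induct)
  case (insert s S)
  obtain m n where "P s m" "\<forall>s\<in>S. P s n" using insert by (metis insertCI)
  then have "\<forall>s'\<in>insert s S. P s' (max m n)" using assms(3) by (metis insertE max.cobounded1 max.cobounded2)
  then show ?case by auto
qed auto

lemma finite_Bij: "finite X \<Longrightarrow> finite (Bij X)"
  by (rule finite_subset[of _ "X \<rightarrow>\<^sub>E X"])
    (auto simp: PiE_def dest: Bij_imp_funcset Bij_imp_extensional intro!: finite_PiE[unfolded PiE_def])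

context dense_tree_action
begin

lemma finite_local_perms:
  assumes "x \<in> V" shows "finite (local_perms T G x)"
  using subgroup.subset[OF subgroup_local_perms[OF assms]] finite_Bij[OF finite_edges_from[OF tree assms]]
  by (auto intro: finite_subset)

end

text \<open>
  For a single pair of vertices a bound exists since the local permutation group is finite, and displacements
  do not change when a lift is conjugated. Hence finitely many pairs suffice, because by the
  hypothesis every pair \<open>(x, y)\<close>, with the given \<open>y\<close>, can be moved into a fixed product of balls.
\<close>

lemma (in two_tree_actions) bounded_lifts:
  assumes y: "y \<in> Y.V"
    and cocompact: "\<And>x. x \<in> X.V \<Longrightarrow> \<exists>l\<in>carrier L. \<phi>1 l x \<in> vertex_ball T1 n x0 \<and> \<phi>2 l y \<in> vertex_ball T2 n y0"
    and x0: "x0 \<in> X.V" and y0: "y0 \<in> Y.V"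
  shows "\<exists>R. \<forall>x\<in>X.V. \<forall>g\<in>G1. g x = x \<longrightarrow>
    (\<exists>l\<in>carrier L. \<phi>1 l x = x \<and> (\<forall>w. (x, w) \<in> parcs T1 \<longrightarrow> \<phi>1 l w = g w) \<and> \<phi>2 l y \<in> vertex_ball T2 R y)"
proof -
  let ?P = "\<lambda>a b f R. \<exists>l\<in>X.stab a. X.loc a l = f \<and> \<phi>2 l b \<in> vertex_ball T2 R b"
  have mono: "?P a b f R'" if "?P a b f R" "R \<le> R'" for a b f R R'
    using that vertex_ball_mono[OF that(2)] by (meson subsetD)
  have mono': "\<forall>f\<in>S. ?P a b f R'" if "\<forall>f\<in>S. ?P a b f R" "R \<le> R'" for S a b R R'
    using mono[OF _ that(2)] that(1) by (intro ballI) (drule bspec)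
  have "\<exists>R. \<forall>f\<in>local_perms T1 G1 a. ?P a b f R" if a: "a \<in> X.V" and b: "b \<in> Y.V" for a b
  proof (rule finite_uniform_bound[OF X.finite_local_perms[OF a]])
    fix f assume "f \<in> local_perms T1 G1 a"
    then obtain l where l: "l \<in> X.stab a" "f = X.loc a l" using X.local_perms_loc[OF a] by auto
    obtain R where "\<phi>2 l b \<in> vertex_ball T2 R b"
      by (rule vertex_ball_exhausts[OF Y.tree b Y.act_closed[OF X.stabD(1)[OF l(1)] b]])
    then show "\<exists>R. ?P a b f R" using l by auto
  qed (rule mono)
  then have "\<exists>R. \<forall>f\<in>local_perms T1 G1 (fst ab). ?P (fst ab) (snd ab) f R"
    if "ab \<in> vertex_ball T1 n x0 \<times> vertex_ball T2 n y0" for ab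
    using that vertex_ball_verts[OF X.tree x0, of n] vertex_ball_verts[OF Y.tree y0, of n]
    by (simp add: mem_Times_iff subset_iff)
  then have "\<exists>R. \<forall>ab\<in>vertex_ball T1 n x0 \<times> vertex_ball T2 n y0.
      \<forall>f\<in>local_perms T1 G1 (fst ab). ?P (fst ab) (snd ab) f R"
    by (rule finite_uniform_bound[OF finite_cartesian_product[OF finite_vertex_ball[OF X.tree] finite_vertex_ball[OF Y.tree]]])
      (assumption, rule mono')
  then obtain R where "\<forall>ab\<in>vertex_ball T1 n x0 \<times> vertex_ball T2 n y0.
      \<forall>f\<in>local_perms T1 G1 (fst ab). ?P (fst ab) (snd ab) f R" ..
  then have R: "a \<in> vertex_ball T1 n x0 \<Longrightarrow> b \<in> vertex_ball T2 n y0 \<Longrightarrow>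
      f \<in> local_perms T1 G1 a \<Longrightarrow> ?P a b f R" for a b f
    by (metis SigmaI fst_conv snd_conv)
  show ?thesis
  proof (intro exI[of _ R] ballI impI)
    fix x g assume x: "x \<in> X.V" and g: "g \<in> G1" "g x = x"
    obtain c where c: "c \<in> carrier L" "\<phi>1 c x \<in> vertex_ball T1 n x0" "\<phi>2 c y \<in> vertex_ball T2 n y0"
      using cocompact[OF x] by auto
    obtain h where h: "h \<in> X.stab x" "\<And>w. (x, w) \<in> parcs T1 \<Longrightarrow> \<phi>1 h w = g w"
      using X.local_lift[OF g x] by metis
    note hL = X.stabD(1)[OF h(1)]
    let ?a = "\<phi>1 c x" and ?h = "c \<otimes> h \<otimes> inv c"
    have aV: "?a \<in> X.V" by (rule X.act_closed[OF c(1) x])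
    have ha: "?h \<in> X.stab ?a"
      using X.conj_fixes[OF c(1) hL x X.stabD(2)[OF h(1)]] c(1) hL by (simp add: X.stab_def)
    then have "X.loc ?a ?h \<in> local_perms T1 G1 ?a" using X.local_perms_loc[OF aV] by auto
    from R[OF c(2,3) this]
    obtain l where l: "l \<in> X.stab ?a" "X.loc ?a l = X.loc ?a ?h" and lb: "\<phi>2 l (\<phi>2 c y) \<in> vertex_ball T2 R (\<phi>2 c y)"
      by auto
    note lL = X.stabD(1)[OF l(1)]
    have lh: "\<phi>1 l v = \<phi>1 ?h v" if "(?a, v) \<in> parcs T1" for v
      using X.loc_eq_iff[OF l(1) ha] l(2) that by simp
    let ?l = "inv c \<otimes> l \<otimes> c"
    have act: "\<phi>1 ?l v = \<phi>1 (inv c) (\<phi>1 l (\<phi>1 c v))" if "v \<in> X.V" for v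
      using that c(1) lL by (simp add: X.act_mult X.act_closed)
    have "\<phi>1 ?l x = x" using act[OF x] X.stabD(2)[OF l(1)] X.act_inv(1)[OF c(1) x] by simp
    moreover have "?l \<in> carrier L" using c(1) lL by simp
    moreover have "\<phi>1 ?l w = g w" if w: "(x, w) \<in> parcs T1" for w
    proof -
      have wV: "w \<in> X.V" using arcs_verts[OF X.tree w] by simp
      have "\<phi>1 l (\<phi>1 c w) = \<phi>1 ?h (\<phi>1 c w)" by (rule lh[OF X.act_arc[OF c(1) w]])
      also have "\<dots> = \<phi>1 c (\<phi>1 h w)" using c(1) hL wV by (simp add: X.act_mult X.act_closed X.act_inv)
      finally have "\<phi>1 ?l w = \<phi>1 (inv c) (\<phi>1 c (\<phi>1 h w))" using act[OF wV] by simp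
      then show ?thesis using X.act_inv(1)[OF c(1) X.act_closed[OF hL wV]] h(2)[OF w] by simp
    qed
    moreover have "\<phi>2 ?l y \<in> vertex_ball T2 R y"
    proof -
      have "\<phi>2 (inv c) (\<phi>2 l (\<phi>2 c y)) \<in> vertex_ball T2 R (\<phi>2 (inv c) (\<phi>2 c y))"
        by (rule Y.act_ball[OF X.inv_closed[OF c(1)] Y.act_closed[OF c(1) y] lb])
      then show ?thesis using c(1) lL y by (simp add: Y.act_mult Y.act_closed Y.act_inv)
    qed
    ultimately show "\<exists>l\<in>carrier L. \<phi>1 l x = x \<and> (\<forall>w. (x, w) \<in> parcs T1 \<longrightarrow> \<phi>1 l w = g w) \<and> \<phi>2 l y \<in> vertex_ball T2 R y"
      by (intro bexI[of _ ?l]) auto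
  qed
qed

section \<open>Local permutation groups of constant type\<close>

lemma (in group_hom) subgroup_preimage:
  assumes K: "subgroup K H" shows "subgroup {g \<in> carrier G. h g \<in> K} G"
proof (rule G.subgroupI)
  have "\<one> \<in> {g \<in> carrier G. h g \<in> K}" using subgroup.one_closed[OF K] by simp
  then show "{g \<in> carrier G. h g \<in> K} \<noteq> {}" by auto
qed (auto intro: subgroup.m_closed[OF K] subgroup.m_inv_closed[OF K])

lemma perm_isomorphic_sym:
  assumes F: "subgroup F (BijGroup X)" and iso: "perm_isomorphic X F Y F'"
  shows "perm_isomorphic Y F' X F"
proof -
  obtain \<beta> \<phi> where \<beta>: "bij_betw \<beta> X Y" and \<phi>: "\<phi> \<in> iso (perm_group X F) (perm_group Y F')"
    and eq: "\<And>f a. f \<in> F \<Longrightarrow> a \<in> X \<Longrightarrow> \<beta> (f a) = \<phi> f (\<beta> a)"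
    using iso unfolding perm_isomorphic_def by metis
  interpret group "perm_group X F" by (rule group_perm_group[OF F])
  have bij: "bij_betw \<phi> F F'" using \<phi> by (simp add: iso_def)
  let ?b = "inv_into X \<beta>" and ?p = "inv_into F \<phi>"
  have "?p \<in> iso (perm_group Y F') (perm_group X F)" using iso_set_sym[OF \<phi>] by simp
  moreover have "bij_betw ?b Y X" by (rule bij_betw_inv_into[OF \<beta>])
  moreover have "?b (f' b) = ?p f' (?b b)" if "f' \<in> F'" "b \<in> Y" for f' b
  proof -
    have f: "?p f' \<in> F" "\<phi> (?p f') = f'" using bij that(1) by (simp_all add: bij_betw_def inv_into_into f_inv_into_f)
    have a: "?b b \<in> X" "\<beta> (?b b) = b" using \<beta> that(2) by (simp_all add: bij_betw_def inv_into_into f_inv_into_f)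
    have "f' b = \<beta> (?p f' (?b b))" using eq[OF f(1) a(1)] f(2) a(2) by simp
    moreover have "?p f' (?b b) \<in> X" using subgroup.subset[OF F] f(1) a(1) Bij_apply[of "?p f'" X] by auto
    ultimately show ?thesis using \<beta> by (simp add: bij_betw_def inv_into_f_f)
  qed
  ultimately show ?thesis unfolding perm_isomorphic_def by (intro exI[of _ ?b] exI[of _ ?p]) simp
qed

lemma perm_isomorphic_trans:
  assumes "perm_isomorphic X F Y F'" "perm_isomorphic Y F' Z F''"
  shows "perm_isomorphic X F Z F''"
proof -
  obtain \<beta> \<phi> where \<beta>: "bij_betw \<beta> X Y" and \<phi>: "\<phi> \<in> iso (perm_group X F) (perm_group Y F')"
    and eq: "\<And>f a. f \<in> F \<Longrightarrow> a \<in> X \<Longrightarrow> \<beta> (f a) = \<phi> f (\<beta> a)"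
    using assms(1) unfolding perm_isomorphic_def by metis
  obtain \<beta>' \<phi>' where \<beta>': "bij_betw \<beta>' Y Z" and \<phi>': "\<phi>' \<in> iso (perm_group Y F') (perm_group Z F'')"
    and eq': "\<And>f a. f \<in> F' \<Longrightarrow> a \<in> Y \<Longrightarrow> \<beta>' (f a) = \<phi>' f (\<beta>' a)"
    using assms(2) unfolding perm_isomorphic_def by metis
  have "\<phi> f \<in> F'" if "f \<in> F" for f using \<phi> that by (auto simp: iso_def bij_betw_def)
  moreover have "\<beta> a \<in> Y" if "a \<in> X" for a using \<beta> that by (auto simp: bij_betw_def)
  ultimately have "\<forall>f\<in>F. \<forall>a\<in>X. (\<beta>' \<circ> \<beta>) (f a) = (\<phi>' \<circ> \<phi>) f ((\<beta>' \<circ> \<beta>) a)" using eq eq' by simp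
  moreover have "\<phi>' \<circ> \<phi> \<in> iso (perm_group X F) (perm_group Z F'')"
    by (rule iso_set_trans[OF \<phi> \<phi>'])
  ultimately show ?thesis unfolding perm_isomorphic_def
    using bij_betw_trans[OF \<beta> \<beta>'] by (intro exI[of _ "\<beta>' \<circ> \<beta>"] exI[of _ "\<phi>' \<circ> \<phi>"]) simp
qed

lemma (in dense_tree_action) local_groups_isomorphic:
  assumes ct: "constant_type T G" and "x \<in> V" "z \<in> V"
  shows "perm_isomorphic (edges_from T x) (local_perms T G x) (edges_from T z) (local_perms T G z)"
proof -
  obtain Y :: "('a \<times> 'a) set" and F
    where "\<forall>x\<in>V. perm_isomorphic (edges_from T x) (local_perms T G x) Y F"
    using ct unfolding constant_type_def by auto
  then show ?thesis
    using perm_isomorphic_trans perm_isomorphic_sym[OF subgroup_local_perms] assms(2,3) by metis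
qed

lemma (in dense_tree_action) local_perms_nontrivial:
  assumes ct: "constant_type T G" and x: "x \<in> V" and z: "z \<in> V"
    and nt: "local_perms T G x \<noteq> {\<one>\<^bsub>local_group T G x\<^esub>}"
  shows "local_perms T G z \<noteq> {\<one>\<^bsub>local_group T G z\<^esub>}"
proof
  assume t: "local_perms T G z = {\<one>\<^bsub>local_group T G z\<^esub>}"
  obtain \<phi> where "\<phi> \<in> iso (local_group T G x) (local_group T G z)"
    using local_groups_isomorphic[OF ct x z] unfolding perm_isomorphic_def by metis
  then have "bij_betw \<phi> (local_perms T G x) (local_perms T G z)" by (simp add: iso_def)
  then have "card (local_perms T G x) = 1" using t bij_betw_same_card by fastforce
  then obtain f where f: "local_perms T G x = {f}" by (rule card_1_singletonE)
  then show False using nt subgroup.one_closed[OF subgroup_local_perms[OF x]] by simp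
qed

lemma minimal_normal_ambient_nontrivial:
  assumes "minimal_normal N (perm_group X F)" shows "F \<noteq> {\<one>\<^bsub>perm_group X F\<^esub>}"
proof
  assume F: "F = {\<one>\<^bsub>perm_group X F\<^esub>}"
  have N: "subgroup N (perm_group X F)" "N \<noteq> {\<one>\<^bsub>perm_group X F\<^esub>}"
    using assms normal_imp_subgroup by (auto simp: minimal_normal_def)
  have "N \<subseteq> F" using subgroup.subset[OF N(1)] by simp
  then show False using F N(2) subgroup.one_closed[OF N(1)] by blast
qed

lemma subgroup_point_stabilizer:
  assumes F: "subgroup F (BijGroup X)" and e: "e \<in> X"
  shows "subgroup (stabilizer (perm_group X F) (\<lambda>f. f) e) (perm_group X F)"
proof -
  have "(\<lambda>f. f) \<in> hom (perm_group X F) (BijGroup X)" using subgroup.subset[OF F] by (auto simp: hom_def)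
  then have "group_action (perm_group X F) X (\<lambda>f. f)"
    using group_perm_group[OF F] group_BijGroup
    by (simp add: group_action_def group_hom_def group_hom_axioms_def)
  then show ?thesis by (rule group_action.stabilizer_subgroup[OF _ e])
qed

section \<open>Simple factors as sections of edge stabilizers\<close>

context two_tree_actions
begin

text \<open>
  Some subgroup \<open>A\<close> of the finite group of elements fixing \<open>x\<close> and the star of \<open>y\<close> maps onto a minimal normal subgroup of
  the local permutation group at \<open>x1\<close>, hence onto \<open>M1\<close>. By \<open>free\<close>, \<open>A\<close> acts faithfully on the second tree, so
  \<open>M1\<close> is already a quotient of the local action, at a vertex \<open>z\<close> of that tree, of a group fixing an edge at \<open>z\<close>.
  Constant type and transitivity of the local permutation group identify the stabilizer of that edge with the
  one of \<open>e2\<close>.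
\<close>

lemma factor_is_section_of_edge_stabilizer:
  assumes y: "y \<in> Y.V"
    and R: "\<And>x g. x \<in> X.V \<Longrightarrow> g \<in> G1 \<Longrightarrow> g x = x \<Longrightarrow>
        \<exists>l\<in>carrier L. \<phi>1 l x = x \<and> (\<forall>w. (x, w) \<in> parcs T1 \<longrightarrow> \<phi>1 l w = g w) \<and> \<phi>2 l y \<in> vertex_ball T2 R y"
    and q: "q \<in> Y.fixator (vertex_ball T2 (R + 1) y)" "u \<in> X.V" "\<phi>1 q u = u"
    and moves: "v \<in> X.V" "\<phi>1 q v \<noteq> v"
    and free: "\<And>k u. k \<in> carrier L \<Longrightarrow> \<forall>v\<in>Y.V. \<phi>2 k v = v \<Longrightarrow> u \<in> X.V \<Longrightarrow> \<phi>1 k u = u \<Longrightarrow> k = \<one>"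
    and x1: "x1 \<in> X.V" and ct1: "constant_type T1 G1"
    and qp1: "quasi_primitive (edges_from T1 x1) (local_perms T1 G1 x1)"
    and N1: "minimal_normal N1 (local_group T1 G1 x1)"
    and M1: "simple_factor M1 (perm_group (edges_from T1 x1) N1)"
    and x2: "x2 \<in> Y.V" and ct2: "constant_type T2 G2"
    and qp2: "quasi_primitive (edges_from T2 x2) (local_perms T2 G2 x2)"
    and N2: "minimal_normal N2 (local_group T2 G2 x2)"
    and e2: "e2 \<in> edges_from T2 x2"
  shows "is_section_of M1 (perm_group (edges_from T2 x2) (stabilizer (local_group T2 G2 x2) (\<lambda>f. f) e2))"
proof -
  have M: "simple_group M1" using M1 by (simp add: simple_factor_def)
  interpret M: simple_group M1 by (rule M)
  obtain x N where x: "x \<in> X.V" and N: "N \<lhd> local_group T1 G1 x" "N \<noteq> {\<one>\<^bsub>local_group T1 G1 x\<^esub>}"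
    and NA: "N \<subseteq> X.loc x ` (X.stab x \<inter> Y.fixator (vertex_ball T2 1 y))"
    by (rule normal_subgroup_from_short_element[OF y R q moves])
  let ?B = "vertex_ball T2 1 y"
  have BV: "?B \<subseteq> Y.V" by (rule vertex_ball_verts[OF Y.tree y])
  let ?Fx = "local_group T1 G1 x" and ?F1 = "local_group T1 G1 x1" and ?E1 = "edges_from T1 x1"
  obtain \<Phi> where \<Phi>: "\<Phi> \<in> iso ?Fx ?F1"
    using X.local_groups_isomorphic[OF ct1 x x1] unfolding perm_isomorphic_def by metis
  have gx: "group ?Fx" and g1: "group ?F1"
    using group_perm_group X.subgroup_local_perms x x1 by metis+
  have \<Phi>h: "group_hom ?Fx ?F1 \<Phi>" using \<Phi> gx g1 by (simp add: group_hom_def group_hom_axioms_def iso_def)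
  have \<Phi>b: "bij_betw \<Phi> (carrier ?Fx) (carrier ?F1)" using \<Phi> by (simp add: iso_def)
  have N': "\<Phi> ` N \<lhd> ?F1"
    by (rule normal.surj_hom_normal_subgroup[OF N(1) \<Phi>h bij_betw_imp_surj_on[OF \<Phi>b]])
  have NF: "N \<subseteq> carrier ?Fx" by (rule subgroup.subset[OF normal_imp_subgroup[OF N(1)]])
  have N'nt: "\<Phi> ` N \<noteq> {\<one>\<^bsub>?F1\<^esub>}"
  proof -
    obtain n where n: "n \<in> N" "n \<noteq> \<one>\<^bsub>?Fx\<^esub>" using N(2) subgroup.one_closed[OF normal_imp_subgroup[OF N(1)]] by auto
    have "\<Phi> n \<noteq> \<Phi> \<one>\<^bsub>?Fx\<^esub>"
      using inj_on_eq_iff[OF bij_betw_imp_inj_on[OF \<Phi>b] subsetD[OF NF n(1)] monoid.one_closed[OF group.is_monoid[OF gx]]] n(2) by simp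
    then show ?thesis using n(1) group_hom.hom_one[OF \<Phi>h] by auto
  qed
  have "finite (carrier ?F1)" using X.finite_local_perms[OF x1] by simp
  from group.contains_minimal_normal[OF g1 this N' N'nt]
  obtain K where K: "minimal_normal K ?F1" and KN: "K \<subseteq> \<Phi> ` N" by metis
  have Ks: "subgroup K ?F1" using K normal_imp_subgroup by (auto simp: minimal_normal_def)
  obtain \<theta> where \<theta>: "\<theta> \<in> epi (perm_group ?E1 K) (perm_group ?E1 N1)"
    using quasi_primitive_minimal_normal_epi[OF X.subgroup_local_perms[OF x1] qp1 N1 K] by auto
  have N1s: "subgroup N1 ?F1" "N1 \<noteq> {\<one>\<^bsub>?F1\<^esub>}" using N1 normal_imp_subgroup by (auto simp: minimal_normal_def)
  have "group (perm_group ?E1 N1)" using group.subgroup_imp_group[OF g1 N1s(1)] by simp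
  moreover have "\<exists>n\<in>carrier (perm_group ?E1 N1). n \<noteq> \<one>\<^bsub>perm_group ?E1 N1\<^esub>"
    using N1s(2) subgroup.one_closed[OF N1s(1)] by auto
  ultimately obtain \<pi> where \<pi>: "\<pi> \<in> epi (perm_group ?E1 N1) M1" using epi_onto_simple_factor M1 by metis
  define h where "h a = \<Phi> (X.loc x a)" for a
  have hh: "group_hom (L\<lparr>carrier := X.stab x\<rparr>) ?F1 h"
  proof -
    have "\<Phi> \<circ> X.loc x \<in> hom (L\<lparr>carrier := X.stab x\<rparr>) ?F1"
      by (rule hom_compose[OF group_hom.homh[OF X.loc_onto_local_group[OF x]] group_hom.homh[OF \<Phi>h]])
    moreover have "h = \<Phi> \<circ> X.loc x" by (auto simp: h_def)
    ultimately show ?thesis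
      using g1 X.subgroup_imp_group[OF X.subgroup_stab[OF x]] by (simp add: group_hom_def group_hom_axioms_def)
  qed
  define A where "A = {a \<in> X.stab x. h a \<in> K} \<inter> Y.fixator ?B"
  have "subgroup {a \<in> X.stab x. h a \<in> K} (L\<lparr>carrier := X.stab x\<rparr>)"
    using group_hom.subgroup_preimage[OF hh Ks] by simp
  then have "subgroup {a \<in> X.stab x. h a \<in> K} L" by (rule X.incl_subgroup[OF X.subgroup_stab[OF x]])
  then have As: "subgroup A L" unfolding A_def
    by (rule X.subgroups_Inter_pair[OF _ Y.subgroup_fixator[OF BV]])
  have AB: "A \<subseteq> Y.fixator ?B" and Ax: "A \<subseteq> X.stab x" and AK: "\<And>a. a \<in> A \<Longrightarrow> h a \<in> K" by (auto simp: A_def)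
  have Afin: "finite A"
  proof (rule finite_subset[OF _ finite_stabilizers[OF x y]])
    show "A \<subseteq> X.stab x \<inter> Y.stab y"
      using Ax AB centre_in_vertex_ball[of y T2 1] by (auto simp: Y.fixator_def Y.stab_def)
  qed
  have hA: "h ` A = K"
  proof
    show "h ` A \<subseteq> K" using AK by auto
    show "K \<subseteq> h ` A"
    proof
      fix k assume k: "k \<in> K"
      then obtain n where n: "n \<in> N" "k = \<Phi> n" using KN by auto
      then obtain a where a: "a \<in> X.stab x" "a \<in> Y.fixator ?B" "n = X.loc x a" using NA by auto
      then have "h a = k" using n(2) by (simp add: h_def)
      then show "k \<in> h ` A" using a k by (auto simp: A_def)
    qed
  qed
  define \<alpha> where "\<alpha> a = \<pi> (\<theta> (h a))" for a
  have \<alpha>: "\<alpha> \<in> epi (L\<lparr>carrier := A\<rparr>) M1"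
  proof -
    have "h \<in> hom (L\<lparr>carrier := A\<rparr>) (perm_group ?E1 K)"
      using group_hom.homh[OF hh] AK Ax by (simp add: hom_def Pi_iff subset_iff)
    then have "\<pi> \<circ> (\<theta> \<circ> h) \<in> hom (L\<lparr>carrier := A\<rparr>) M1"
      using \<theta> \<pi> by (intro hom_compose[of _ _ "perm_group ?E1 N1"] hom_compose[of _ _ "perm_group ?E1 K"]) (simp_all add: epi_def)
    moreover have "\<alpha> = \<pi> \<circ> (\<theta> \<circ> h)" by (auto simp: \<alpha>_def)
    moreover have "\<alpha> ` A = \<pi> ` \<theta> ` h ` A" by (simp add: \<alpha>_def image_image)
    ultimately show ?thesis using \<theta> \<pi> hA by (simp add: epi_def)
  qed
  have Afaithful: "a = \<one>" if "a \<in> A" "\<forall>v\<in>Y.V. \<phi>2 a v = v" for a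
    using free[OF _ that(2) x] X.stabD subsetD[OF Ax that(1)] by simp
  from Y.simple_quotient_seen_at_edge[OF M y As Afin AB Afaithful \<alpha>]
  obtain C z w where C: "subgroup C L" and zw: "(z, w) \<in> parcs T2" and Cf: "C \<subseteq> Y.fixator {z, w}"
    and \<alpha>C: "\<alpha> \<in> epi (L\<lparr>carrier := C\<rparr>) M1"
    and ker: "\<And>b. b \<in> C \<Longrightarrow> Y.loc z b = \<one>\<^bsub>BijGroup (edges_from T2 z)\<^esub> \<Longrightarrow> \<alpha> b = \<one>\<^bsub>M1\<^esub>"
    by auto
  have zV: "z \<in> Y.V" using arcs_verts[OF Y.tree zw] by simp
  have Cz: "C \<subseteq> Y.stab z" and Cw: "\<And>c. c \<in> C \<Longrightarrow> \<phi>2 c w = w"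
    using Cf by (auto simp: Y.fixator_def Y.stab_def)
  let ?Fz = "local_group T2 G2 z" and ?F2 = "local_group T2 G2 x2" and ?E2 = "edges_from T2 x2"
  have gz: "group ?Fz" and g2: "group ?F2"
    using group_perm_group Y.subgroup_local_perms zV x2 by metis+
  interpret F2: group ?F2 by (rule g2)
  note F2s = Y.subgroup_local_perms[OF x2]
  obtain \<beta> \<Psi> where \<beta>: "bij_betw \<beta> (edges_from T2 z) ?E2" and \<Psi>: "\<Psi> \<in> iso ?Fz ?F2"
    and eq: "\<And>f a. f \<in> local_perms T2 G2 z \<Longrightarrow> a \<in> edges_from T2 z \<Longrightarrow> \<beta> (f a) = \<Psi> f (\<beta> a)"
    using Y.local_groups_isomorphic[OF ct2 zV x2] unfolding perm_isomorphic_def by metis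
  have \<Psi>h: "group_hom ?Fz ?F2 \<Psi>" using \<Psi> gz g2 by (simp add: group_hom_def group_hom_axioms_def iso_def)
  have ezw: "(z, w) \<in> edges_from T2 z" using zw by (simp add: in_edges_from)
  then have \<beta>e: "\<beta> (z, w) \<in> ?E2" using bij_betw_apply[OF \<beta>] by simp
  have "carrier ?F2 \<lhd> ?F2" by (rule F2.normal_invI[OF F2.subgroup_self]) (intro F2.m_closed F2.inv_closed)
  then have F2n: "local_perms T2 G2 x2 \<lhd> ?F2" by simp
  obtain f where f: "f \<in> local_perms T2 G2 x2" "f (\<beta> (z, w)) = e2"
    by (rule quasi_primitive_transitive[OF qp2 F2n minimal_normal_ambient_nontrivial[OF N2] \<beta>e e2])
  define \<psi> where "\<psi> c = f \<otimes>\<^bsub>?F2\<^esub> \<Psi> (Y.loc z c) \<otimes>\<^bsub>?F2\<^esub> inv\<^bsub>?F2\<^esub> f" for c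
  have fF: "f \<in> carrier ?F2" using f(1) by simp
  have locF: "Y.loc z c \<in> carrier ?Fz" if "c \<in> C" for c
    using Y.local_perms_loc[OF zV] that Cz by auto
  have \<Psi>F: "\<Psi> (Y.loc z c) \<in> carrier ?F2" if "c \<in> C" for c
    by (rule group_hom.hom_closed[OF \<Psi>h locF[OF that]])
  have \<psi>F: "\<psi> c \<in> carrier ?F2" if "c \<in> C" for c
    unfolding \<psi>_def by (intro F2.m_closed F2.inv_closed fF \<Psi>F that)
  let ?St = "stabilizer ?F2 (\<lambda>f. f) e2"
  have \<psi>St: "\<psi> c \<in> ?St" if c: "c \<in> C" for c
  proof -
    let ?i = "inv\<^bsub>?F2\<^esub> f" and ?m = "\<Psi> (Y.loc z c)"
    have iF: "?i \<in> local_perms T2 G2 x2" using F2.inv_closed[OF fF] by simp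
    have mF: "?m \<in> local_perms T2 G2 x2" using \<Psi>F[OF c] by simp
    have fm: "f \<otimes>\<^bsub>?F2\<^esub> ?m \<in> local_perms T2 G2 x2" using F2.m_closed[OF fF \<Psi>F[OF c]] by simp
    have i: "?i e2 = \<beta> (z, w)" using perm_group_inv_apply(2)[OF F2s f(1) \<beta>e] f(2) by simp
    have "Y.loc z c (z, w) = (z, w)" using Y.loc_apply[OF zw subsetD[OF Cz c]] Cw[OF c] by simp
    then have m: "?m (\<beta> (z, w)) = \<beta> (z, w)" using eq[of "Y.loc z c", OF _ ezw] locF[OF c] by simp
    have "\<psi> c = compose ?E2 (f \<otimes>\<^bsub>?F2\<^esub> ?m) ?i"
      unfolding \<psi>_def by (rule perm_group_mult[OF F2s fm iF])
    also have "f \<otimes>\<^bsub>?F2\<^esub> ?m = compose ?E2 f ?m" by (rule perm_group_mult[OF F2s f(1) mF])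
    finally have "\<psi> c = compose ?E2 (compose ?E2 f ?m) ?i" .
    then have "\<psi> c e2 = e2" using e2 i m f(2) \<beta>e by (simp add: compose_eq)
    then show ?thesis using \<psi>F[OF c] unfolding stabilizer_def by blast
  qed
  have \<psi>mult: "\<psi> (c \<otimes> d) = \<psi> c \<otimes>\<^bsub>?F2\<^esub> \<psi> d" if c: "c \<in> C" and d: "d \<in> C" for c d
  proof -
    have "Y.loc z (c \<otimes> d) = Y.loc z c \<otimes>\<^bsub>?Fz\<^esub> Y.loc z d"
      using group_hom.hom_mult[OF Y.loc_onto_local_group[OF zV], of c d] c d Cz by auto
    then have "\<Psi> (Y.loc z (c \<otimes> d)) = \<Psi> (Y.loc z c) \<otimes>\<^bsub>?F2\<^esub> \<Psi> (Y.loc z d)"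
      using group_hom.hom_mult[OF \<Psi>h locF[OF c] locF[OF d]] by simp
    moreover have "f \<otimes>\<^bsub>?F2\<^esub> (a \<otimes>\<^bsub>?F2\<^esub> b) \<otimes>\<^bsub>?F2\<^esub> inv\<^bsub>?F2\<^esub> f =
        (f \<otimes>\<^bsub>?F2\<^esub> a \<otimes>\<^bsub>?F2\<^esub> inv\<^bsub>?F2\<^esub> f) \<otimes>\<^bsub>?F2\<^esub> (f \<otimes>\<^bsub>?F2\<^esub> b \<otimes>\<^bsub>?F2\<^esub> inv\<^bsub>?F2\<^esub> f)"
      if ab: "a \<in> carrier ?F2" "b \<in> carrier ?F2" for a b
    proof -
      have "inv\<^bsub>?F2\<^esub> f \<otimes>\<^bsub>?F2\<^esub> (f \<otimes>\<^bsub>?F2\<^esub> (b \<otimes>\<^bsub>?F2\<^esub> inv\<^bsub>?F2\<^esub> f)) = b \<otimes>\<^bsub>?F2\<^esub> inv\<^bsub>?F2\<^esub> f"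
        using F2.m_assoc[OF F2.inv_closed[OF fF] fF F2.m_closed[OF ab(2) F2.inv_closed[OF fF]]]
          F2.l_inv[OF fF] F2.l_one[OF F2.m_closed[OF ab(2) F2.inv_closed[OF fF]]] by simp
      then show ?thesis
        using ab fF by (simp only: F2.m_assoc F2.inv_closed F2.m_closed)
    qed
    ultimately show ?thesis unfolding \<psi>_def using \<Psi>F[OF c] \<Psi>F[OF d] by simp
  qed
  have "\<psi> \<in> hom (L\<lparr>carrier := C\<rparr>) (perm_group ?E2 ?St)"
    using \<psi>St \<psi>mult by (simp add: hom_def)
  moreover have "\<alpha> c = \<one>\<^bsub>M1\<^esub>" if "c \<in> carrier (L\<lparr>carrier := C\<rparr>)" "\<psi> c = \<one>\<^bsub>perm_group ?E2 ?St\<^esub>" for c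
  proof (rule ker)
    show c: "c \<in> C" using that(1) by simp
    have 1: "f \<otimes>\<^bsub>?F2\<^esub> \<Psi> (Y.loc z c) \<otimes>\<^bsub>?F2\<^esub> inv\<^bsub>?F2\<^esub> f = \<one>\<^bsub>?F2\<^esub>" using that(2) by (simp add: \<psi>_def)
    have "f \<otimes>\<^bsub>?F2\<^esub> \<Psi> (Y.loc z c) = f"
      using F2.inv_solve_right'[OF F2.one_closed F2.m_closed[OF fF \<Psi>F[OF c]] fF] 1 F2.l_one[OF fF]
      by (metis F2.inv_equality F2.inv_inv F2.inv_closed F2.m_closed \<Psi>F[OF c] fF)
    then have "\<Psi> (Y.loc z c) = \<one>\<^bsub>?F2\<^esub>" using F2.l_cancel_one[OF fF \<Psi>F[OF c]] by simp
    then have "\<Psi> (Y.loc z c) = \<Psi> \<one>\<^bsub>?Fz\<^esub>" using group_hom.hom_one[OF \<Psi>h] by simp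
    moreover have "inj_on \<Psi> (carrier ?Fz)" using \<Psi> by (simp add: iso_def bij_betw_def)
    ultimately have "Y.loc z c = \<one>\<^bsub>?Fz\<^esub>"
      using locF[OF c] monoid.one_closed[OF group.is_monoid[OF gz]] by (metis inj_onD)
    then show "Y.loc z c = \<one>\<^bsub>BijGroup (edges_from T2 z)\<^esub>" by simp
  qed
  moreover have "group (perm_group ?E2 ?St)"
    using F2.subgroup_imp_group[OF subgroup_point_stabilizer[OF F2s e2]] by simp
  ultimately show ?thesis
    using quotient_section[OF X.subgroup_imp_group[OF C] _ M.group_axioms \<alpha>C] by metis
qed

end

section \<open>From topological to combinatorial hypotheses\<close>

lemma topspace_aut_topology: "topspace (aut_topology T) = automorphisms T"
proof -
  have "automorphisms T \<subseteq> (\<Pi>\<^sub>E v\<in>pverts T. pverts T)"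
    by (auto simp: automorphisms_def PiE_def dest: Bij_imp_funcset Bij_imp_extensional)
  then show ?thesis by (auto simp: aut_topology_def)
qed

lemma topspace_subgroup_topology:
  "G \<subseteq> automorphisms T \<Longrightarrow> topspace (subtopology (aut_topology T) G) = G"
  by (auto simp: topspace_aut_topology)

lemma openin_cylinder:
  assumes G: "G \<subseteq> automorphisms T" and P: "finite P" "P \<subseteq> pverts T"
  shows "openin (subtopology (aut_topology T) G) {g \<in> G. \<forall>p\<in>P. g p = c p}"
  using P
proof (induction P rule: finite_induct)
  case empty
  then show ?case using openin_topspace[of "subtopology (aut_topology T) G"]
    unfolding topspace_subgroup_topology[OF G] by simp
next
  case (insert q P)
  let ?X = "subtopology (aut_topology T) G"
  have "continuous_map (product_topology (\<lambda>_. discrete_topology (pverts T)) (pverts T))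
      (discrete_topology (pverts T)) (\<lambda>g. g q)"
    using insert.prems by (intro continuous_map_product_projection) simp
  then have cont: "continuous_map ?X (discrete_topology (pverts T)) (\<lambda>g. g q)"
    unfolding aut_topology_def by (intro continuous_map_from_subtopology)
  have "openin ?X {g \<in> topspace ?X. g q \<in> {c q} \<inter> pverts T}"
    by (rule openin_continuous_map_preimage[OF cont]) simp
  moreover have "{g \<in> topspace ?X. g q \<in> {c q} \<inter> pverts T} = {g \<in> G. g q = c q}"
    unfolding topspace_subgroup_topology[OF G]
    using G insert.prems by (auto simp: automorphisms_def dest: Bij_apply)
  ultimately have "openin ?X {g \<in> G. g q = c q}" by simp
  moreover have "openin ?X {g \<in> G. \<forall>p\<in>P. g p = c p}" using insert by simp
  ultimately have "openin ?X ({g \<in> G. g q = c q} \<inter> {g \<in> G. \<forall>p\<in>P. g p = c p})" by (rule openin_Int)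
  moreover have "{g \<in> G. \<forall>p\<in>insert q P. g p = c p} = {g \<in> G. g q = c q} \<inter> {g \<in> G. \<forall>p\<in>P. g p = c p}"
    by auto
  ultimately show ?case by simp
qed

lemma cylinder_neighbourhood:
  assumes U: "openin (subtopology (aut_topology T) G) U" and g: "g \<in> U"
  obtains P where "finite P" "P \<subseteq> pverts T"
    "\<And>h. h \<in> G \<Longrightarrow> h \<in> automorphisms T \<Longrightarrow> \<forall>p\<in>P. h p = g p \<Longrightarrow> h \<in> U"
proof -
  let ?V = "pverts T"
  let ?X = "product_topology (\<lambda>_. discrete_topology ?V) ?V"
  obtain S where S: "openin ?X S" "U = S \<inter> automorphisms T \<inter> G"
    using U unfolding aut_topology_def openin_subtopology by (metis inf_assoc)
  obtain W where W: "finite {i \<in> ?V. W i \<noteq> ?V}" "g \<in> Pi\<^sub>E ?V W" "Pi\<^sub>E ?V W \<subseteq> S"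
    using S g unfolding openin_product_topology_alt by (metis IntD1 topspace_discrete_topology)
  show thesis
  proof (rule that[of "{i \<in> ?V. W i \<noteq> ?V}"])
    fix h assume h: "h \<in> G" "h \<in> automorphisms T" "\<forall>p\<in>{i \<in> ?V. W i \<noteq> ?V}. h p = g p"
    have hB: "h \<in> Bij ?V" using h(2) by (simp add: automorphisms_def)
    have "h i \<in> W i" if "i \<in> ?V" for i
    proof (cases "W i = ?V")
      case True
      then show ?thesis using Bij_apply[OF hB that] by simp
    next
      case False
      then show ?thesis using h(3) that W(2) by (simp add: PiE_mem)
    qed
    then have "h \<in> Pi\<^sub>E ?V W" using Bij_imp_extensional[OF hB] by (simp add: PiE_iff)
    then show "h \<in> U" using S(2) W(3) h(1,2) by auto
  qed (use W(1) in auto)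
qed

lemma tree_action_self:
  assumes T: "locally_finite_tree T" and G: "subgroup G (aut_group T)"
  shows "dense_tree_action (perm_group (pverts T) G) T (\<lambda>g. g) G"
proof -
  have sub: "G \<subseteq> automorphisms T" by (rule aut_subgroup_automorphisms[OF T G])
  have "group (perm_group (pverts T) G)" by (rule group_perm_group[OF aut_subgroup_Bij[OF T G]])
  moreover have "(\<lambda>g. g) \<in> hom (perm_group (pverts T) G) (aut_group T)" using sub by (auto simp: hom_def)
  ultimately have "tree_action (perm_group (pverts T) G) T (\<lambda>g. g)"
    using T group_aut_group[OF T] by (simp add: tree_action_def group_hom_def group_hom_axioms_def)
  then show ?thesis
    using G by (auto simp: dense_tree_action_def dense_tree_action_axioms_def)
qed

lemma non_discrete_moves:
  assumes T: "locally_finite_tree T" and G: "subgroup G (aut_group T)"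
    and nd: "\<not> discrete_in (aut_topology T) G" and P: "finite P" "P \<subseteq> pverts T"
  shows "\<exists>g\<in>G. (\<forall>p\<in>P. g p = p) \<and> (\<exists>q\<in>pverts T. g q \<noteq> q)"
proof (rule ccontr)
  assume no: "\<not> ?thesis"
  interpret dense_tree_action "perm_group (pverts T) G" T "\<lambda>g. g" G by (rule tree_action_self[OF T G])
  have sub: "G \<subseteq> automorphisms T" by (rule aut_subgroup_automorphisms[OF T G])
  have "openin (subtopology (aut_topology T) G) {g}" if g: "g \<in> G" for g
  proof -
    have "{h \<in> G. \<forall>p\<in>P. h p = g p} = {g}"
    proof (intro equalityI subsetI)
      fix h assume "h \<in> {h \<in> G. \<forall>p\<in>P. h p = g p}"
      then have h: "h \<in> G" and hg: "\<And>p. p \<in> P \<Longrightarrow> h p = g p" by auto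
      let ?L = "perm_group (pverts T) G"
      let ?k = "inv\<^bsub>?L\<^esub> g \<otimes>\<^bsub>?L\<^esub> h"
      have gh: "g \<in> carrier ?L" "h \<in> carrier ?L" using g h by simp_all
      have k: "?k v = (inv\<^bsub>?L\<^esub> g) (h v)" if "v \<in> pverts T" for v
        by (rule act_mult[OF inv_closed[OF gh(1)] gh(2) that])
      have "?k p = p" if "p \<in> P" for p
      proof -
        have pV: "p \<in> pverts T" using that P(2) by auto
        show ?thesis unfolding k[OF pV] hg[OF that] by (rule act_inv(1)[OF gh(1) pV])
      qed
      moreover have "?k \<in> G" using m_closed[OF inv_closed[OF gh(1)] gh(2)] by simp
      ultimately have kq: "?k q = q" if "q \<in> pverts T" for q using no that by metis
      have "h = g"
      proof (rule Bij_eqI)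
        show "h \<in> Bij (pverts T)" "g \<in> Bij (pverts T)" using g h sub by (auto simp: automorphisms_def)
        fix q assume q: "q \<in> pverts T"
        have "h q = g ((inv\<^bsub>?L\<^esub> g) (h q))" using act_inv(2)[OF gh(1) act_closed[OF gh(2) q]] by simp
        also have "\<dots> = g q" using kq[OF q] k[OF q] by simp
        finally show "h q = g q" .
      qed
      then show "h \<in> {g}" by simp
    qed (use g in simp)
    then show ?thesis using openin_cylinder[OF sub P, of g] by simp
  qed
  then have "discrete_topology G = subtopology (aut_topology T) G"
    unfolding discrete_topology_unique using topspace_subgroup_topology[OF sub] by simp
  then show False using nd by (simp add: discrete_in_def)
qed

lemma dense_agrees_on_finite_set:
  assumes G: "G \<subseteq> automorphisms T" and dense: "subtopology (aut_topology T) G closure_of D = G"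
    and g: "g \<in> G" and P: "finite P" "P \<subseteq> pverts T"
  shows "\<exists>d\<in>D. \<forall>p\<in>P. d p = g p"
proof -
  have "g \<in> subtopology (aut_topology T) G closure_of D" using dense g by simp
  moreover have "openin (subtopology (aut_topology T) G) {h \<in> G. \<forall>p\<in>P. h p = g p}"
    by (rule openin_cylinder[OF G P])
  moreover have "g \<in> {h \<in> G. \<forall>p\<in>P. h p = g p}" using g by simp
  ultimately have "\<exists>d. d \<in> D \<and> d \<in> {h \<in> G. \<forall>p\<in>P. h p = g p}"
    unfolding in_closure_of by meson
  then show ?thesis by auto
qed

lemma discrete_subset_separated:
  assumes G1: "G1 \<subseteq> automorphisms T1" and G2: "G2 \<subseteq> automorphisms T2"
    and D: "D \<subseteq> G1 \<times> G2" and disc: "discrete_in (tree_prod_topology T1 G1 T2 G2) D" and d: "(a, b) \<in> D"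
  shows "\<exists>P Q. finite P \<and> P \<subseteq> pverts T1 \<and> finite Q \<and> Q \<subseteq> pverts T2 \<and>
    (\<forall>a' b'. (a', b') \<in> D \<longrightarrow> (\<forall>p\<in>P. a' p = a p) \<longrightarrow> (\<forall>q\<in>Q. b' q = b q) \<longrightarrow> (a', b') = (a, b))"
proof -
  let ?X = "tree_prod_topology T1 G1 T2 G2"
  have "openin (subtopology ?X D) {(a, b)}" using disc d by (simp add: discrete_in_def)
  then obtain U where U: "openin ?X U" "{(a, b)} = U \<inter> D" unfolding openin_subtopology by auto
  then have "(a, b) \<in> U" by auto
  then obtain U1 U2 where U12: "openin (subtopology (aut_topology T1) G1) U1" "openin (subtopology (aut_topology T2) G2) U2"
    "a \<in> U1" "b \<in> U2" "U1 \<times> U2 \<subseteq> U"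
    using U(1) unfolding openin_prod_topology_alt by metis
  obtain P where P: "finite P" "P \<subseteq> pverts T1" "\<And>h. h \<in> G1 \<Longrightarrow> h \<in> automorphisms T1 \<Longrightarrow> \<forall>p\<in>P. h p = a p \<Longrightarrow> h \<in> U1"
    by (rule cylinder_neighbourhood[OF U12(1,3)]) auto
  obtain Q where Q: "finite Q" "Q \<subseteq> pverts T2" "\<And>h. h \<in> G2 \<Longrightarrow> h \<in> automorphisms T2 \<Longrightarrow> \<forall>q\<in>Q. h q = b q \<Longrightarrow> h \<in> U2"
    by (rule cylinder_neighbourhood[OF U12(2,4)]) auto
  have "(a', b') = (a, b)" if "(a', b') \<in> D" "\<forall>p\<in>P. a' p = a p" "\<forall>q\<in>Q. b' q = b q" for a' b'
  proof -
    have "a' \<in> G1" "b' \<in> G2" using that(1) D by auto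
    then have "a' \<in> U1" "b' \<in> U2" using P(3)[of a'] Q(3)[of b'] that G1 G2 by auto
    then have "(a', b') \<in> U \<inter> D" using U12(5) that(1) by auto
    then show ?thesis using U(2) by auto
  qed
  then show ?thesis using P(1,2) Q(1,2) by (intro exI[of _ P] exI[of _ Q]) auto
qed

lemma group_tree_prod:
  assumes "locally_finite_tree T1" "locally_finite_tree T2"
    and "subgroup G1 (aut_group T1)" "subgroup G2 (aut_group T2)"
  shows "group (tree_prod_group T1 G1 T2 G2)"
  by (intro DirProd_group group_perm_group aut_subgroup_Bij assms)

text \<open>
  The topological hypotheses enter the main argument only through this lemma, \<open>non_discrete_moves\<close> and
  \<open>cocompact_bounded_orbits\<close>.
\<close>

lemma two_tree_actions_of_discrete_subgroup:
  assumes T: "locally_finite_tree T1" "locally_finite_tree T2"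
    and G: "subgroup G1 (aut_group T1)" "subgroup G2 (aut_group T2)"
    and D: "discrete_subgroup (tree_prod_group T1 G1 T2 G2) (tree_prod_topology T1 G1 T2 G2) D"
    and \<Gamma>: "\<Gamma> \<subseteq> D"
    and dense: "subtopology (aut_topology T1) G1 closure_of (fst ` \<Gamma>) = G1"
               "subtopology (aut_topology T2) G2 closure_of (snd ` \<Gamma>) = G2"
  shows "two_tree_actions (tree_prod_group T1 G1 T2 G2\<lparr>carrier := D\<rparr>) T1 fst G1 T2 snd G2"
proof -
  let ?G = "tree_prod_group T1 G1 T2 G2"
  let ?L = "?G\<lparr>carrier := D\<rparr>"
  have sub: "G1 \<subseteq> automorphisms T1" "G2 \<subseteq> automorphisms T2"
    using aut_subgroup_automorphisms T G by metis+
  interpret G: group ?G by (rule group_tree_prod[OF T G])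
  have Ds: "subgroup D ?G" and disc: "discrete_in (tree_prod_topology T1 G1 T2 G2) D"
    using D by (auto simp: discrete_subgroup_def)
  have DG: "D \<subseteq> G1 \<times> G2" using subgroup.subset[OF Ds] by (simp add: DirProd_def)
  interpret L: group ?L by (rule G.subgroup_imp_group[OF Ds])
  have hom1: "fst \<in> hom ?L (aut_group T1)" and hom2: "snd \<in> hom ?L (aut_group T2)"
    using DG sub by (auto simp: hom_def DirProd_def)
  have "dense_tree_action ?L T1 fst G1"
    unfolding dense_tree_action_def dense_tree_action_axioms_def tree_action_def group_hom_def group_hom_axioms_def
  proof (intro conjI allI impI)
    fix g P assume "g \<in> G1" "finite P" "P \<subseteq> pverts T1"
    from dense_agrees_on_finite_set[OF sub(1) dense(1) this]
    show "\<exists>l\<in>carrier ?L. \<forall>p\<in>P. fst l p = g p" using \<Gamma> by auto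
  qed (use T G hom1 DG L.group_axioms group_aut_group[OF T(1)] in auto)
  moreover have "dense_tree_action ?L T2 snd G2"
    unfolding dense_tree_action_def dense_tree_action_axioms_def tree_action_def group_hom_def group_hom_axioms_def
  proof (intro conjI allI impI)
    fix g P assume "g \<in> G2" "finite P" "P \<subseteq> pverts T2"
    from dense_agrees_on_finite_set[OF sub(2) dense(2) this]
    show "\<exists>l\<in>carrier ?L. \<forall>p\<in>P. snd l p = g p" using \<Gamma> by auto
  qed (use T G hom2 DG L.group_axioms group_aut_group[OF T(2)] in auto)
  moreover have "\<exists>P Q. finite P \<and> P \<subseteq> pverts T1 \<and> finite Q \<and> Q \<subseteq> pverts T2 \<and>
    (\<forall>g\<in>carrier ?L. (\<forall>p\<in>P. fst g p = p) \<longrightarrow> (\<forall>q\<in>Q. snd g q = q) \<longrightarrow> g = \<one>\<^bsub>?L\<^esub>)"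
  proof -
    have one: "\<one>\<^bsub>?L\<^esub> = ((\<lambda>v\<in>pverts T1. v), (\<lambda>v\<in>pverts T2. v))" by (simp add: DirProd_def)
    then have "((\<lambda>v\<in>pverts T1. v), (\<lambda>v\<in>pverts T2. v)) \<in> D" using subgroup.one_closed[OF Ds] by simp
    from discrete_subset_separated[OF sub DG disc this]
    obtain P Q where PQ: "finite P" "P \<subseteq> pverts T1" "finite Q" "Q \<subseteq> pverts T2"
      and sep: "\<And>a b. (a, b) \<in> D \<Longrightarrow> \<forall>p\<in>P. a p = (\<lambda>v\<in>pverts T1. v) p \<Longrightarrow> \<forall>q\<in>Q. b q = (\<lambda>v\<in>pverts T2. v) q \<Longrightarrow>
        (a, b) = ((\<lambda>v\<in>pverts T1. v), (\<lambda>v\<in>pverts T2. v))"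
      by metis
    have "g = \<one>\<^bsub>?L\<^esub>" if "g \<in> carrier ?L" "\<forall>p\<in>P. fst g p = p" "\<forall>q\<in>Q. snd g q = q" for g
    proof -
      have "(fst g, snd g) = ((\<lambda>v\<in>pverts T1. v), (\<lambda>v\<in>pverts T2. v))"
        by (rule sep) (use that PQ in auto)
      then show ?thesis unfolding one by simp
    qed
    then show ?thesis using PQ by (intro exI[of _ P] exI[of _ Q]) simp
  qed
  ultimately show ?thesis by (simp add: two_tree_actions_def two_tree_actions_axioms_def)
qed

text \<open>
  Local transitivity propagates along paths: \<open>G\<close> has at most two orbits on vertices.
\<close>

lemma orbits_meet_star:
  assumes T: "locally_finite_tree T" and G: "subgroup G (aut_group T)"
    and qp: "locally_quasi_primitive T G"
    and nt: "\<And>x. x \<in> pverts T \<Longrightarrow> local_perms T G x \<noteq> {\<one>\<^bsub>local_group T G x\<^esub>}"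
    and x0: "x0 \<in> pverts T" and x: "x \<in> pverts T"
  shows "\<exists>h\<in>G. \<exists>a\<in>vertex_ball T 1 x0. x = h a"
proof -
  let ?L = "perm_group (pverts T) G"
  interpret dense_tree_action ?L T "\<lambda>g. g" G by (rule tree_action_self[OF T G])
  let ?D = "vertex_ball T 1 x0"
  have DV: "?D \<subseteq> pverts T" by (rule vertex_ball_verts[OF T x0])
  have "pverts T \<subseteq> {v. \<exists>h\<in>G. \<exists>a\<in>?D. v = h a}"
  proof (rule closed_under_neighbours[OF T _ x0])
    have "x0 = \<one>\<^bsub>?L\<^esub> x0" using act_one[OF x0] by simp
    moreover have "\<one>\<^bsub>?L\<^esub> \<in> G" using one_closed by simp
    ultimately show "x0 \<in> {v. \<exists>h\<in>G. \<exists>a\<in>?D. v = h a}" using centre_in_vertex_ball[of x0 T 1] by blast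
  next
    fix v w assume "v \<in> {v. \<exists>h\<in>G. \<exists>a\<in>?D. v = h a}" and vw: "(v, w) \<in> parcs T"
    then obtain h a where h: "h \<in> G" and a: "a \<in> ?D" and v: "v = h a" by auto
    have hL: "h \<in> carrier ?L" using h by simp
    have aV: "a \<in> pverts T" using a DV by auto
    have wV: "w \<in> pverts T" using arcs_verts[OF T vw] by simp
    define b where "b = (inv\<^bsub>?L\<^esub> h) w"
    have w: "w = h b" using act_inv(2)[OF hL wV] by (simp add: b_def)
    have ab: "(a, b) \<in> parcs T"
      using act_arc[OF inv_closed[OF hL] vw] act_inv(1)[OF hL aV] by (simp add: v b_def)
    show "w \<in> {v. \<exists>h\<in>G. \<exists>a\<in>?D. v = h a}"
    proof (cases "a = x0")
      case True
      then have "b \<in> ?D" using ab unfolding vertex_ball_1 by simp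
      then show ?thesis using h w by auto
    next
      case False
      then have "(x0, a) \<in> parcs T" using a unfolding vertex_ball_1 by simp
      from arcs_sym[OF T this] have ax: "(a, x0) \<in> parcs T" .
      have "quasi_primitive (edges_from T a) (local_perms T G a)"
        using qp aV by (simp add: locally_quasi_primitive_def)
      from stab_transitive_on_star[OF aV this nt[OF aV] ax ab]
      obtain g where g: "g \<in> stab a" "g x0 = b" by auto
      note gL = stabD(1)[OF g(1)]
      have "w = (h \<otimes>\<^bsub>?L\<^esub> g) x0" unfolding act_mult[OF hL gL x0] g(2) by (rule w)
      moreover have "h \<otimes>\<^bsub>?L\<^esub> g \<in> G" using m_closed[OF hL gL] by simp
      ultimately show ?thesis using centre_in_vertex_ball[of x0 T 1] by blast
    qed
  qed
  then show ?thesis using x by auto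
qed

text \<open>
  The sets \<open>O' c\<close> of elements that agree with \<open>c\<close> on the base point up to right multiplication by \<open>\<Gamma>\<close> are open and unions
  of cosets of \<open>\<Gamma>\<close>, so their images are open in the quotient and finitely many of them cover it.
\<close>

lemma cocompact_finite_cover:
  assumes T: "locally_finite_tree T1" "locally_finite_tree T2"
    and G: "subgroup G1 (aut_group T1)" "subgroup G2 (aut_group T2)"
    and \<Gamma>: "subgroup \<Gamma> (tree_prod_group T1 G1 T2 G2)"
    and cocompact: "cocompact (tree_prod_group T1 G1 T2 G2) (tree_prod_topology T1 G1 T2 G2) \<Gamma>"
    and x: "x1 \<in> pverts T1" "x2 \<in> pverts T2"
  shows "\<exists>C. finite C \<and> C \<subseteq> G1 \<times> G2 \<and>
    (\<forall>g\<in>G1 \<times> G2. \<exists>c\<in>C. \<exists>\<gamma>\<in>\<Gamma>. fst g (fst \<gamma> x1) = fst c x1 \<and> snd g (snd \<gamma> x2) = snd c x2)"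
proof -
  let ?G = "tree_prod_group T1 G1 T2 G2" and ?X = "tree_prod_topology T1 G1 T2 G2"
  have sub: "G1 \<subseteq> automorphisms T1" "G2 \<subseteq> automorphisms T2"
    using aut_subgroup_automorphisms T G by metis+
  interpret G: group ?G by (rule group_tree_prod[OF T G])
  have carG: "carrier ?G = G1 \<times> G2" by (simp add: DirProd_def)
  have \<Gamma>G: "\<Gamma> \<subseteq> G1 \<times> G2" using subgroup.subset[OF \<Gamma>] carG by simp
  have topX: "topspace ?X = G1 \<times> G2"
    by (simp only: topspace_prod_topology topspace_subgroup_topology[OF sub(1)] topspace_subgroup_topology[OF sub(2)])
  have actV: "fst g v \<in> pverts T1" "snd g w \<in> pverts T2"
    if g: "g \<in> G1 \<times> G2" and vw: "v \<in> pverts T1" "w \<in> pverts T2" for g v w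
  proof -
    have "fst g \<in> automorphisms T1" "snd g \<in> automorphisms T2" using g sub by auto
    then have "fst g \<in> Bij (pverts T1)" "snd g \<in> Bij (pverts T2)" by (simp_all add: automorphisms_def)
    from Bij_apply[OF this(1) vw(1)] Bij_apply[OF this(2) vw(2)]
    show "fst g v \<in> pverts T1" "snd g w \<in> pverts T2" .
  qed
  have mult: "fst (g \<otimes>\<^bsub>?G\<^esub> h) v = fst g (fst h v)" "snd (g \<otimes>\<^bsub>?G\<^esub> h) w = snd g (snd h w)"
    if "g \<in> G1 \<times> G2" "h \<in> G1 \<times> G2" "v \<in> pverts T1" "w \<in> pverts T2" for g h v w
  proof -
    have "fst g \<in> automorphisms T1" "snd g \<in> automorphisms T2" "fst h \<in> automorphisms T1" "snd h \<in> automorphisms T2"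
      using that(1,2) sub by auto
    then have B: "fst g \<in> Bij (pverts T1)" "snd g \<in> Bij (pverts T2)" "fst h \<in> Bij (pverts T1)" "snd h \<in> Bij (pverts T2)"
      by (simp_all add: automorphisms_def)
    show "fst (g \<otimes>\<^bsub>?G\<^esub> h) v = fst g (fst h v)" "snd (g \<otimes>\<^bsub>?G\<^esub> h) w = snd g (snd h w)"
      using B that(3,4) by (simp_all add: DirProd_def BijGroup_mult compose_eq split_beta)
  qed
  let ?\<pi> = "\<lambda>g. g <#\<^bsub>?G\<^esub> \<Gamma>"
  obtain Y where q: "quotient_map ?X Y ?\<pi>" and Y: "compact_space Y" using cocompact unfolding cocompact_def by auto
  define O' where "O' c = {g \<in> G1 \<times> G2. \<exists>\<gamma>\<in>\<Gamma>. fst g (fst \<gamma> x1) = fst c x1 \<and> snd g (snd \<gamma> x2) = snd c x2}" for c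
  have openO: "openin ?X (O' c)" for c
  proof -
    have "O' c = (\<Union>\<gamma>\<in>\<Gamma>. {g \<in> G1. \<forall>p\<in>{fst \<gamma> x1}. g p = fst c x1} \<times> {g \<in> G2. \<forall>p\<in>{snd \<gamma> x2}. g p = snd c x2})"
    proof (intro equalityI subsetI)
      fix g assume "g \<in> O' c"
      then obtain \<gamma> where "\<gamma> \<in> \<Gamma>" and
        "g \<in> {g \<in> G1. \<forall>p\<in>{fst \<gamma> x1}. g p = fst c x1} \<times> {g \<in> G2. \<forall>p\<in>{snd \<gamma> x2}. g p = snd c x2}"
        unfolding O'_def mem_Times_iff by auto
      then show "g \<in> (\<Union>\<gamma>\<in>\<Gamma>. {g \<in> G1. \<forall>p\<in>{fst \<gamma> x1}. g p = fst c x1} \<times> {g \<in> G2. \<forall>p\<in>{snd \<gamma> x2}. g p = snd c x2})"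
        by (rule UN_I)
    next
      fix g assume "g \<in> (\<Union>\<gamma>\<in>\<Gamma>. {g \<in> G1. \<forall>p\<in>{fst \<gamma> x1}. g p = fst c x1} \<times> {g \<in> G2. \<forall>p\<in>{snd \<gamma> x2}. g p = snd c x2})"
      then obtain \<gamma> where "\<gamma> \<in> \<Gamma>" "fst g \<in> G1" "snd g \<in> G2" "fst g (fst \<gamma> x1) = fst c x1" "snd g (snd \<gamma> x2) = snd c x2"
        by auto
      then show "g \<in> O' c" unfolding O'_def mem_Times_iff by (intro CollectI conjI bexI[of _ \<gamma>]) auto
    qed
    moreover have "openin ?X ({g \<in> G1. \<forall>p\<in>{fst \<gamma> x1}. g p = fst c x1} \<times> {g \<in> G2. \<forall>p\<in>{snd \<gamma> x2}. g p = snd c x2})"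
      if \<gamma>: "\<gamma> \<in> \<Gamma>" for \<gamma>
    proof -
      have V: "fst \<gamma> x1 \<in> pverts T1" "snd \<gamma> x2 \<in> pverts T2" using actV[OF subsetD[OF \<Gamma>G \<gamma>] x] .
      show ?thesis
        unfolding openin_prod_Times_iff
        using openin_cylinder[OF sub(1), of "{fst \<gamma> x1}" "\<lambda>_. fst c x1"] openin_cylinder[OF sub(2), of "{snd \<gamma> x2}" "\<lambda>_. snd c x2"] V
        by simp
    qed
    ultimately show ?thesis by auto
  qed
  have saturated: "g \<in> O' c" if g: "g \<in> G1 \<times> G2" and h: "h \<in> O' c" and eq: "?\<pi> g = ?\<pi> h" for g h c
  proof -
    obtain \<gamma> where \<gamma>: "\<gamma> \<in> \<Gamma>" "fst h (fst \<gamma> x1) = fst c x1" "snd h (snd \<gamma> x2) = snd c x2" and hG: "h \<in> G1 \<times> G2"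
      using h by (auto simp: O'_def)
    have "h \<otimes>\<^bsub>?G\<^esub> \<one>\<^bsub>?G\<^esub> \<in> ?\<pi> h" using subgroup.one_closed[OF \<Gamma>] unfolding l_coset_def by auto
    then have "h \<in> ?\<pi> g" using hG carG eq G.r_one[of h] by simp
    then obtain \<delta> where \<delta>: "\<delta> \<in> \<Gamma>" "h = g \<otimes>\<^bsub>?G\<^esub> \<delta>" unfolding l_coset_def by auto
    have \<delta>\<gamma>: "\<delta> \<otimes>\<^bsub>?G\<^esub> \<gamma> \<in> \<Gamma>" by (rule subgroup.m_closed[OF \<Gamma> \<delta>(1) \<gamma>(1)])
    have in_G: "\<delta> \<in> G1 \<times> G2" "\<gamma> \<in> G1 \<times> G2" using \<delta> \<gamma> \<Gamma>G by auto
    have V: "fst \<gamma> x1 \<in> pverts T1" "snd \<gamma> x2 \<in> pverts T2" using actV[OF in_G(2) x] .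
    have "fst g (fst (\<delta> \<otimes>\<^bsub>?G\<^esub> \<gamma>) x1) = fst c x1" "snd g (snd (\<delta> \<otimes>\<^bsub>?G\<^esub> \<gamma>) x2) = snd c x2"
      using \<gamma>(2,3) mult[OF g in_G(1) V] mult[OF in_G x] \<delta>(2) by simp_all
    then show ?thesis using g \<delta>\<gamma> unfolding O'_def by blast
  qed
  have openY: "openin Y (?\<pi> ` O' c)" for c
  proof -
    have surj: "?\<pi> ` topspace ?X = topspace Y" by (rule quotient_imp_surjective_map[OF q])
    have O'X: "O' c \<subseteq> topspace ?X" unfolding topX O'_def by auto
    have sat: "{g \<in> topspace ?X. ?\<pi> g \<in> ?\<pi> ` O' c} = O' c"
    proof (intro equalityI subsetI)
      fix g assume "g \<in> {g \<in> topspace ?X. ?\<pi> g \<in> ?\<pi> ` O' c}"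
      then obtain h where "g \<in> G1 \<times> G2" "h \<in> O' c" "?\<pi> g = ?\<pi> h" unfolding topX by auto
      then show "g \<in> O' c" by (rule saturated)
    qed (use O'X in auto)
    have subY: "?\<pi> ` O' c \<subseteq> topspace Y" unfolding surj[symmetric] by (rule image_mono[OF O'X])
    have "openin ?X {g \<in> topspace ?X. ?\<pi> g \<in> ?\<pi> ` O' c} = openin Y (?\<pi> ` O' c)"
      using q subY unfolding quotient_map_def by meson
    then show ?thesis unfolding sat using openO[of c] by (rule iffD1)
  qed
  have "topspace Y \<subseteq> \<Union> ((\<lambda>c. ?\<pi> ` O' c) ` (G1 \<times> G2))"
  proof
    fix y assume "y \<in> topspace Y"
    then have "y \<in> ?\<pi> ` (G1 \<times> G2)" using quotient_imp_surjective_map[OF q] unfolding topX by simp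
    then obtain g where g: "g \<in> G1 \<times> G2" "y = ?\<pi> g" by (elim imageE)
    have one: "\<one>\<^bsub>?G\<^esub> \<in> \<Gamma>" by (rule subgroup.one_closed[OF \<Gamma>])
    have "fst \<one>\<^bsub>?G\<^esub> x1 = x1" "snd \<one>\<^bsub>?G\<^esub> x2 = x2" using x by (simp_all add: DirProd_def)
    then have "g \<in> O' g" unfolding O'_def using g(1) one by (intro CollectI conjI bexI[OF _ one]) simp_all
    then show "y \<in> \<Union> ((\<lambda>c. ?\<pi> ` O' c) ` (G1 \<times> G2))" using g by blast
  qed
  moreover have "\<forall>U\<in>(\<lambda>c. ?\<pi> ` O' c) ` (G1 \<times> G2). openin Y U" using openY by auto
  ultimately obtain F where F: "finite F" "F \<subseteq> (\<lambda>c. ?\<pi> ` O' c) ` (G1 \<times> G2)" "topspace Y \<subseteq> \<Union> F"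
    using Y unfolding compact_space_alt by (metis (no_types, lifting))
  obtain C where C: "C \<subseteq> G1 \<times> G2" "finite C" "F = (\<lambda>c. ?\<pi> ` O' c) ` C"
    using finite_subset_image[OF F(1,2)] by metis
  have "\<exists>c\<in>C. \<exists>\<gamma>\<in>\<Gamma>. fst g (fst \<gamma> x1) = fst c x1 \<and> snd g (snd \<gamma> x2) = snd c x2" if g: "g \<in> G1 \<times> G2" for g
  proof -
    have "?\<pi> g \<in> topspace Y" using quotient_imp_surjective_map[OF q] imageI[OF g, of ?\<pi>] unfolding topX by simp
    then obtain c where c: "c \<in> C" "?\<pi> g \<in> ?\<pi> ` O' c" using F(3) C(3) by auto
    then obtain h where "h \<in> O' c" "?\<pi> g = ?\<pi> h" by auto
    then have "g \<in> O' c" using saturated g by metis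
    then show ?thesis using c(1) by (auto simp: O'_def)
  qed
  then show ?thesis using C by (intro exI[of _ C]) simp
qed

text \<open>
  Every pair of vertices has the form \<open>(h p, k q)\<close> with \<open>p\<close>, \<open>q\<close> in the stars of the base points. Applying the
  finite cover to \<open>(h\<inverse>, k\<inverse>)\<close> gives \<open>\<gamma> \<in> \<Gamma>\<close> that moves the base points to the \<open>(h, k)\<close>-translate of one of finitely
  many pairs, hence close to the given pair.
\<close>

lemma cocompact_bounded_orbits:
  assumes T: "locally_finite_tree T1" "locally_finite_tree T2"
    and G: "subgroup G1 (aut_group T1)" "subgroup G2 (aut_group T2)"
    and \<Gamma>: "subgroup \<Gamma> (tree_prod_group T1 G1 T2 G2)"
    and cocompact: "cocompact (tree_prod_group T1 G1 T2 G2) (tree_prod_topology T1 G1 T2 G2) \<Gamma>"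
    and qp: "locally_quasi_primitive T1 G1" "locally_quasi_primitive T2 G2"
    and nt1: "\<And>x. x \<in> pverts T1 \<Longrightarrow> local_perms T1 G1 x \<noteq> {\<one>\<^bsub>local_group T1 G1 x\<^esub>}"
    and nt2: "\<And>x. x \<in> pverts T2 \<Longrightarrow> local_perms T2 G2 x \<noteq> {\<one>\<^bsub>local_group T2 G2 x\<^esub>}"
    and base: "x1 \<in> pverts T1" "x2 \<in> pverts T2"
  shows "\<exists>n. \<forall>x\<in>pverts T1. \<forall>y\<in>pverts T2.
    \<exists>a b. (a, b) \<in> \<Gamma> \<and> x \<in> vertex_ball T1 n (a x1) \<and> y \<in> vertex_ball T2 n (b x2)"
proof -
  let ?L1 = "perm_group (pverts T1) G1" and ?L2 = "perm_group (pverts T2) G2"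
  interpret A: dense_tree_action ?L1 T1 "\<lambda>g. g" G1 by (rule tree_action_self[OF T(1) G(1)])
  interpret B: dense_tree_action ?L2 T2 "\<lambda>g. g" G2 by (rule tree_action_self[OF T(2) G(2)])
  obtain C where C: "finite C" "C \<subseteq> G1 \<times> G2" and cover: "\<And>g. g \<in> G1 \<times> G2 \<Longrightarrow>
      \<exists>c\<in>C. \<exists>\<gamma>\<in>\<Gamma>. fst g (fst \<gamma> x1) = fst c x1 \<and> snd g (snd \<gamma> x2) = snd c x2"
    using cocompact_finite_cover[OF T G \<Gamma> cocompact base] by metis
  have \<Gamma>G: "\<Gamma> \<subseteq> G1 \<times> G2" using subgroup.subset[OF \<Gamma>] by (simp add: DirProd_def)
  have "\<exists>m. \<forall>c\<in>C. fst c x1 \<in> vertex_ball T1 m x1 \<and> snd c x2 \<in> vertex_ball T2 m x2"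
  proof (rule finite_uniform_bound[OF C(1)])
    fix c assume "c \<in> C"
    then have c: "fst c \<in> carrier ?L1" "snd c \<in> carrier ?L2" using C(2) by auto
    obtain m where m: "fst c x1 \<in> vertex_ball T1 m x1"
      by (rule vertex_ball_exhausts[OF T(1) base(1) A.act_closed[OF c(1) base(1)]])
    obtain n where n: "snd c x2 \<in> vertex_ball T2 n x2"
      by (rule vertex_ball_exhausts[OF T(2) base(2) B.act_closed[OF c(2) base(2)]])
    have "fst c x1 \<in> vertex_ball T1 (max m n) x1" "snd c x2 \<in> vertex_ball T2 (max m n) x2"
      using subsetD[OF vertex_ball_mono m] subsetD[OF vertex_ball_mono n] by simp_all
    then show "\<exists>m. fst c x1 \<in> vertex_ball T1 m x1 \<and> snd c x2 \<in> vertex_ball T2 m x2" by auto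
  next
    fix c m n assume "fst c x1 \<in> vertex_ball T1 m x1 \<and> snd c x2 \<in> vertex_ball T2 m x2" "m \<le> n"
    then show "fst c x1 \<in> vertex_ball T1 n x1 \<and> snd c x2 \<in> vertex_ball T2 n x2"
      by (meson vertex_ball_mono subsetD)
  qed
  then obtain m where m: "\<And>c. c \<in> C \<Longrightarrow> fst c x1 \<in> vertex_ball T1 m x1 \<and> snd c x2 \<in> vertex_ball T2 m x2"
    by auto
  have "\<exists>a b. (a, b) \<in> \<Gamma> \<and> x \<in> vertex_ball T1 (m + 1) (a x1) \<and> y \<in> vertex_ball T2 (m + 1) (b x2)"
    if x: "x \<in> pverts T1" and y: "y \<in> pverts T2" for x y
  proof -
    obtain h p where h: "h \<in> carrier ?L1" "p \<in> vertex_ball T1 1 x1" "x = h p"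
      using orbits_meet_star[OF T(1) G(1) qp(1) nt1 base(1) x] by auto
    obtain k q where k: "k \<in> carrier ?L2" "q \<in> vertex_ball T2 1 x2" "y = k q"
      using orbits_meet_star[OF T(2) G(2) qp(2) nt2 base(2) y] by auto
    let ?h = "inv\<^bsub>?L1\<^esub> h" and ?k = "inv\<^bsub>?L2\<^esub> k"
    have "?h \<in> G1" "?k \<in> G2" using A.inv_closed[OF h(1)] B.inv_closed[OF k(1)] by simp_all
    then have "(?h, ?k) \<in> G1 \<times> G2" by simp
    from cover[OF this] obtain c \<gamma> where c: "c \<in> C" and \<gamma>: "\<gamma> \<in> \<Gamma>"
      and eq: "?h (fst \<gamma> x1) = fst c x1" "?k (snd \<gamma> x2) = snd c x2" by auto
    have \<gamma>L: "fst \<gamma> \<in> carrier ?L1" "snd \<gamma> \<in> carrier ?L2" using \<gamma> \<Gamma>G by auto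
    have cL: "fst c \<in> carrier ?L1" "snd c \<in> carrier ?L2" using c C(2) by auto
    have \<gamma>x: "fst \<gamma> x1 = h (fst c x1)" "snd \<gamma> x2 = k (snd c x2)"
      using A.act_inv(2)[OF h(1) A.act_closed[OF \<gamma>L(1) base(1)]] B.act_inv(2)[OF k(1) B.act_closed[OF \<gamma>L(2) base(2)]] eq
      by simp_all
    have "p \<in> vertex_ball T1 (m + 1) (fst c x1)" "q \<in> vertex_ball T2 (m + 1) (snd c x2)"
      using vertex_ball_trans[OF vertex_ball_sym[OF T(1)] h(2)] vertex_ball_trans[OF vertex_ball_sym[OF T(2)] k(2)] m[OF c]
      by simp_all
    then have "x \<in> vertex_ball T1 (m + 1) (fst \<gamma> x1)" "y \<in> vertex_ball T2 (m + 1) (snd \<gamma> x2)"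
      unfolding \<gamma>x h(3) k(3)
      using A.act_ball[OF h(1) A.act_closed[OF cL(1) base(1)]] B.act_ball[OF k(1) B.act_closed[OF cL(2) base(2)]] by simp_all
    then show ?thesis using \<gamma> by (intro exI[of _ "fst \<gamma>"] exI[of _ "snd \<gamma>"]) simp
  qed
  then show ?thesis by (intro exI[of _ "m + 1"]) simp
qed

lemma (in two_tree_actions) bounded_lifts_from_orbits:
  assumes y: "y \<in> Y.V" and x0: "x0 \<in> X.V"
    and orbits: "\<And>x. x \<in> X.V \<Longrightarrow> \<exists>l\<in>carrier L. x \<in> vertex_ball T1 n (\<phi>1 l x0) \<and> y \<in> vertex_ball T2 n (\<phi>2 l y)"
  shows "\<exists>R. \<forall>x\<in>X.V. \<forall>g\<in>G1. g x = x \<longrightarrow>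
    (\<exists>l\<in>carrier L. \<phi>1 l x = x \<and> (\<forall>w. (x, w) \<in> parcs T1 \<longrightarrow> \<phi>1 l w = g w) \<and> \<phi>2 l y \<in> vertex_ball T2 R y)"
proof (rule bounded_lifts[OF y _ x0 y])
  fix x assume x: "x \<in> X.V"
  obtain l where l: "l \<in> carrier L" "x \<in> vertex_ball T1 n (\<phi>1 l x0)" "y \<in> vertex_ball T2 n (\<phi>2 l y)"
    using orbits[OF x] by auto
  have "\<phi>1 (inv l) x \<in> vertex_ball T1 n x0" "\<phi>2 (inv l) y \<in> vertex_ball T2 n y"
    using X.act_ball[OF X.inv_closed[OF l(1)] X.act_closed[OF l(1) x0] l(2)] X.act_inv(1)[OF l(1) x0]
      Y.act_ball[OF X.inv_closed[OF l(1)] Y.act_closed[OF l(1) y] l(3)] Y.act_inv(1)[OF l(1) y] by simp_all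
  then show "\<exists>l\<in>carrier L. \<phi>1 l x \<in> vertex_ball T1 n x0 \<and> \<phi>2 l y \<in> vertex_ball T2 n y"
    using X.inv_closed[OF l(1)] by (intro bexI[of _ "inv l"]) simp
qed

section \<open>Discrete overgroups of a cocompact lattice\<close>

theorem theorem2p3:
  fixes T1 :: "'a pair_pre_digraph" and T2 :: "'b pair_pre_digraph"
    and G1 :: "('a \<Rightarrow> 'a) set" and G2 :: "('b \<Rightarrow> 'b) set"
    and M1 :: "'m1 monoid" and M2 :: "'m2 monoid"
    and \<Gamma> :: "(('a \<Rightarrow> 'a) \<times> ('b \<Rightarrow> 'b)) set"
  assumes trees: "locally_finite_tree T1" "locally_finite_tree T2"
    and subgroups: "subgroup G1 (aut_group T1)" "subgroup G2 (aut_group T2)"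
    and closed: "closedin (aut_topology T1) G1" "closedin (aut_topology T2) G2"
    and non_discrete: "\<not> discrete_in (aut_topology T1) G1" "\<not> discrete_in (aut_topology T2) G2"
    and quasi_prim: "locally_quasi_primitive T1 G1" "locally_quasi_primitive T2 G2"
    and const_type: "constant_type T1 G1" "constant_type T2 G2"
    and vertices: "x1 \<in> pverts T1" "x2 \<in> pverts T2"
    and min_normal: "minimal_normal N1 (local_group T1 G1 x1)"
                    "minimal_normal N2 (local_group T2 G2 x2)"
    and factors: "simple_factor M1 (perm_group (edges_from T1 x1) N1)"
                 "simple_factor M2 (perm_group (edges_from T2 x2) N2)"
    and edges: "e1 \<in> edges_from T1 x1" "e2 \<in> edges_from T2 x2"
    and S1: "S1 = perm_group (edges_from T1 x1) (stabilizer (local_group T1 G1 x1) (\<lambda>f. f) e1)"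
    and S2: "S2 = perm_group (edges_from T2 x2) (stabilizer (local_group T2 G2 x2) (\<lambda>f. f) e2)"
    and lattice: "lattice_subgroup (tree_prod_group T1 G1 T2 G2) (tree_prod_topology T1 G1 T2 G2) \<Gamma>"
    and cocompact: "cocompact (tree_prod_group T1 G1 T2 G2) (tree_prod_topology T1 G1 T2 G2) \<Gamma>"
    and dense: "subtopology (aut_topology T1) G1 closure_of (fst ` \<Gamma>) = G1"
               "subtopology (aut_topology T2) G2 closure_of (snd ` \<Gamma>) = G2"
  shows "\<exists>W. (\<exists>U. openin (tree_prod_topology T1 G1 T2 G2) U \<and>
                  \<one>\<^bsub>tree_prod_group T1 G1 T2 G2\<^esub> \<in> U \<and> U \<subseteq> W) \<and>
             W \<subseteq> G1 \<times> G2 \<and>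
             (\<forall>\<Lambda>. discrete_subgroup (tree_prod_group T1 G1 T2 G2) (tree_prod_topology T1 G1 T2 G2) \<Lambda> \<and>
                  \<Gamma> \<subseteq> \<Lambda> \<and> \<Lambda> \<inter> W \<noteq> {\<one>\<^bsub>tree_prod_group T1 G1 T2 G2\<^esub>} \<longrightarrow>
                  is_section_of M1 S2 \<and> is_section_of M2 S1)"
proof -
  let ?G = "tree_prod_group T1 G1 T2 G2" and ?X = "tree_prod_topology T1 G1 T2 G2"
  have sub: "G1 \<subseteq> automorphisms T1" "G2 \<subseteq> automorphisms T2"
    using aut_subgroup_automorphisms trees subgroups by metis+
  have one: "\<one>\<^bsub>?G\<^esub> = ((\<lambda>v\<in>pverts T1. v), (\<lambda>v\<in>pverts T2. v))" by (simp add: DirProd_def)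
  have \<Gamma>D: "discrete_subgroup ?G ?X \<Gamma>" using lattice by (simp add: lattice_subgroup_def)
  have \<Gamma>s: "subgroup \<Gamma> ?G" using \<Gamma>D by (simp add: discrete_subgroup_def)
  interpret A: two_tree_actions "?G\<lparr>carrier := \<Gamma>\<rparr>" T1 fst G1 T2 snd G2
    by (rule two_tree_actions_of_discrete_subgroup[OF trees subgroups \<Gamma>D order_refl dense])
  have nt1: "local_perms T1 G1 x \<noteq> {\<one>\<^bsub>local_group T1 G1 x\<^esub>}" if "x \<in> pverts T1" for x
    by (rule A.X.local_perms_nontrivial[OF const_type(1) vertices(1) that minimal_normal_ambient_nontrivial[OF min_normal(1)]])
  have nt2: "local_perms T2 G2 x \<noteq> {\<one>\<^bsub>local_group T2 G2 x\<^esub>}" if "x \<in> pverts T2" for x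
    by (rule A.Y.local_perms_nontrivial[OF const_type(2) vertices(2) that minimal_normal_ambient_nontrivial[OF min_normal(2)]])
  have nd1: "\<exists>g\<in>G1. (\<forall>p\<in>P. g p = p) \<and> (\<exists>q\<in>pverts T1. g q \<noteq> q)" if "finite P" "P \<subseteq> pverts T1" for P
    by (rule non_discrete_moves[OF trees(1) subgroups(1) non_discrete(1) that])
  have nd2: "\<exists>g\<in>G2. (\<forall>p\<in>P. g p = p) \<and> (\<exists>q\<in>pverts T2. g q \<noteq> q)" if "finite P" "P \<subseteq> pverts T2" for P
    by (rule non_discrete_moves[OF trees(2) subgroups(2) non_discrete(2) that])
  obtain n where n: "\<And>x y. x \<in> pverts T1 \<Longrightarrow> y \<in> pverts T2 \<Longrightarrow>
      \<exists>a b. (a, b) \<in> \<Gamma> \<and> x \<in> vertex_ball T1 n (a x1) \<and> y \<in> vertex_ball T2 n (b x2)"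
    using cocompact_bounded_orbits[OF trees subgroups \<Gamma>s cocompact quasi_prim nt1 nt2 vertices] by metis
  have "\<exists>R. \<forall>x\<in>pverts T1. \<forall>g\<in>G1. g x = x \<longrightarrow>
      (\<exists>l\<in>carrier (?G\<lparr>carrier := \<Gamma>\<rparr>). fst l x = x \<and> (\<forall>w. (x, w) \<in> parcs T1 \<longrightarrow> fst l w = g w) \<and>
        snd l x2 \<in> vertex_ball T2 R x2)"
  proof (rule A.bounded_lifts_from_orbits[OF vertices(2,1)])
    fix x assume "x \<in> pverts T1"
    from n[OF this vertices(2)] show "\<exists>l\<in>carrier (?G\<lparr>carrier := \<Gamma>\<rparr>).
        x \<in> vertex_ball T1 n (fst l x1) \<and> x2 \<in> vertex_ball T2 n (snd l x2)" by force
  qed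
  then obtain R where R: "\<And>x g. x \<in> pverts T1 \<Longrightarrow> g \<in> G1 \<Longrightarrow> g x = x \<Longrightarrow>
      \<exists>l\<in>\<Gamma>. fst l x = x \<and> (\<forall>w. (x, w) \<in> parcs T1 \<longrightarrow> fst l w = g w) \<and> snd l x2 \<in> vertex_ball T2 R x2"
    by auto
  have "\<exists>R. \<forall>x\<in>pverts T2. \<forall>g\<in>G2. g x = x \<longrightarrow>
      (\<exists>l\<in>carrier (?G\<lparr>carrier := \<Gamma>\<rparr>). snd l x = x \<and> (\<forall>w. (x, w) \<in> parcs T2 \<longrightarrow> snd l w = g w) \<and>
        fst l x1 \<in> vertex_ball T1 R x1)"
  proof (rule two_tree_actions.bounded_lifts_from_orbits[OF A.swap vertices])
    fix x assume "x \<in> pverts T2"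
    from n[OF vertices(1) this] show "\<exists>l\<in>carrier (?G\<lparr>carrier := \<Gamma>\<rparr>).
        x \<in> vertex_ball T2 n (snd l x2) \<and> x1 \<in> vertex_ball T1 n (fst l x1)" by force
  qed
  then obtain R' where R': "\<And>x g. x \<in> pverts T2 \<Longrightarrow> g \<in> G2 \<Longrightarrow> g x = x \<Longrightarrow>
      \<exists>l\<in>\<Gamma>. snd l x = x \<and> (\<forall>w. (x, w) \<in> parcs T2 \<longrightarrow> snd l w = g w) \<and> fst l x1 \<in> vertex_ball T1 R' x1"
    by auto
  let ?B1 = "vertex_ball T1 (R' + 1) x1" and ?B2 = "vertex_ball T2 (R + 1) x2"
  have BV: "?B1 \<subseteq> pverts T1" "?B2 \<subseteq> pverts T2"
    using vertex_ball_verts trees vertices by metis+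
  \<comment> \<open>The radii come from \<open>\<Gamma>\<close> alone, so \<open>W\<close> is chosen before \<open>\<Lambda>\<close>; one extra step makes room for a star.\<close>
  define W where "W = {g \<in> G1. \<forall>p\<in>?B1. g p = p} \<times> {g \<in> G2. \<forall>p\<in>?B2. g p = p}"
  have openW: "openin ?X W"
    unfolding W_def openin_prod_Times_iff
    using openin_cylinder[OF sub(1) finite_vertex_ball[OF trees(1)] BV(1), of "\<lambda>p. p"]
      openin_cylinder[OF sub(2) finite_vertex_ball[OF trees(2)] BV(2), of "\<lambda>p. p"] by simp
  have oneW: "\<one>\<^bsub>?G\<^esub> \<in> W"
    using subgroup.one_closed[OF subgroups(1)] subgroup.one_closed[OF subgroups(2)] BV
    by (auto simp: W_def DirProd_def)
  have WG: "W \<subseteq> G1 \<times> G2" by (auto simp: W_def)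
  have main: "is_section_of M1 S2 \<and> is_section_of M2 S1"
    if \<Lambda>: "discrete_subgroup ?G ?X \<Lambda>" "\<Gamma> \<subseteq> \<Lambda>" "\<Lambda> \<inter> W \<noteq> {\<one>\<^bsub>?G\<^esub>}" for \<Lambda>
  proof -
    let ?L = "?G\<lparr>carrier := \<Lambda>\<rparr>"
    interpret B: two_tree_actions ?L T1 fst G1 T2 snd G2
      by (rule two_tree_actions_of_discrete_subgroup[OF trees subgroups \<Lambda>(1,2) dense])
    interpret C: two_tree_actions ?L T2 snd G2 T1 fst G1 by (rule B.swap)
    have oneL: "\<one>\<^bsub>?L\<^esub> = \<one>\<^bsub>?G\<^esub>" by simp
    have "\<one>\<^bsub>?G\<^esub> \<in> \<Lambda>" using B.X.one_closed by simp
    then obtain q where q: "q \<in> \<Lambda>" "q \<in> W" "q \<noteq> \<one>\<^bsub>?L\<^esub>" using \<Lambda>(3) oneW unfolding oneL by auto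
    have qL: "q \<in> carrier ?L" using q(1) by simp
    have free1: "k = \<one>\<^bsub>?L\<^esub>" if "k \<in> carrier ?L" "\<forall>v\<in>pverts T2. snd k v = v" "u \<in> pverts T1" "fst k u = u" for k u
      by (rule B.trivial_on_other_tree_imp_free[OF nd1 quasi_prim(1) nt1 that vertices(2)])
    have free2: "k = \<one>\<^bsub>?L\<^esub>" if "k \<in> carrier ?L" "\<forall>v\<in>pverts T1. fst k v = v" "u \<in> pverts T2" "snd k u = u" for k u
      by (rule C.trivial_on_other_tree_imp_free[OF nd2 quasi_prim(2) nt2 that vertices(1)])
    have fix1: "fst q p = p" if "p \<in> ?B1" for p using q(2) that by (auto simp: W_def)
    have fix2: "snd q p = p" if "p \<in> ?B2" for p using q(2) that by (auto simp: W_def)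
    have qx: "fst q x1 = x1" "snd q x2 = x2" using fix1 fix2 centre_in_vertex_ball by metis+
    obtain v where v: "v \<in> pverts T1" "fst q v \<noteq> v" using free2[OF qL _ vertices(2) qx(2)] q(3) by auto
    obtain w where w: "w \<in> pverts T2" "snd q w \<noteq> w" using free1[OF qL _ vertices(1) qx(1)] q(3) by auto
    have qp1: "quasi_primitive (edges_from T1 x1) (local_perms T1 G1 x1)"
      and qp2: "quasi_primitive (edges_from T2 x2) (local_perms T2 G2 x2)"
      using quasi_prim vertices by (simp_all add: locally_quasi_primitive_def)
    have qf2: "q \<in> B.Y.fixator ?B2" using qL fix2 by (simp add: B.Y.fixator_def)
    have qf1: "q \<in> B.X.fixator ?B1" using qL fix1 by (simp add: B.X.fixator_def)
    have R\<Lambda>: "\<exists>l\<in>carrier ?L. fst l x = x \<and> (\<forall>w. (x, w) \<in> parcs T1 \<longrightarrow> fst l w = g w) \<and> snd l x2 \<in> vertex_ball T2 R x2"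
      if "x \<in> pverts T1" "g \<in> G1" "g x = x" for x g using R[OF that] \<Lambda>(2) by auto
    have R'\<Lambda>: "\<exists>l\<in>carrier ?L. snd l x = x \<and> (\<forall>w. (x, w) \<in> parcs T2 \<longrightarrow> snd l w = g w) \<and> fst l x1 \<in> vertex_ball T1 R' x1"
      if "x \<in> pverts T2" "g \<in> G2" "g x = x" for x g using R'[OF that] \<Lambda>(2) by auto
    have "is_section_of M1 S2" unfolding S2
      by (rule B.factor_is_section_of_edge_stabilizer[OF vertices(2) R\<Lambda> qf2 vertices(1) qx(1) v free1
            vertices(1) const_type(1) qp1 min_normal(1) factors(1) vertices(2) const_type(2) qp2 min_normal(2) edges(2)])
    moreover have "is_section_of M2 S1" unfolding S1
      by (rule C.factor_is_section_of_edge_stabilizer[OF vertices(1) R'\<Lambda> qf1 vertices(2) qx(2) w free2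
            vertices(2) const_type(2) qp2 min_normal(2) factors(2) vertices(1) const_type(1) qp1 min_normal(1) edges(1)])
    ultimately show ?thesis by simp
  qed
  have nbhd: "\<exists>U. openin ?X U \<and> \<one>\<^bsub>?G\<^esub> \<in> U \<and> U \<subseteq> W" using openW oneW by (intro exI[of _ W] conjI order_refl)
  show ?thesis
    by (rule exI[of _ W], rule conjI[OF nbhd conjI[OF WG]], intro allI impI) (elim conjE, rule main)
qed

end
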